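(* Let $(\Gamma, L)$ be an $n$-dimensional periodic graph and let $x_0 \in V_\Gamma$. Let $d$ be a positive integer, let $N$ be a finitely generated submonoid of $L^d$, and let $Y$ be a finitely generated $N$-submodule of $V_\Gamma^d$. Then the multivariate growth series $\mathbb{B}_{Y,x_0}(\mathbf{z})$ and $\mathbb{S}_{Y,x_0}(\mathbf{z})$ in $\mathbb{Z}[[z_1,\ldots,z_d]]$ are rational functions.
   Context: Graphs. A graph $\Gamma = (V_\Gamma, E_\Gamma, s, t, w)$ is a directed weighted graph, possibly with loops and multiple edges: $V_\Gamma$ is the set of vertices, $E_\Gamma$ the set of edges, $s, t : E_\Gamma \to V_\Gamma$ the source and target functions, and $w : E_\Gamma \to \mathbb{Z}_{>0}$ the weight function. A walk is a sequence $p = e_1 e_2 \cdots e_\ell$ of edges with $t(e_i) = s(e_{i+1})$ for $1 \le i \le \ell-1$; its weight is $w(p) := \sum_{i=1}^{\ell} w(e_i)$. Walks of length $0$ (from a vertex to itself, weight $0$) are allowed. For $x,y \in V_\Gamma$, $d_\Gamma(x,y) \in \mathbb{Z}_{\ge 0} \cup \{\infty\}$ is the smallest weight of a walk from $x$ to $y$ ($\infty$ if there is none). Periodic graphs. Let $n$ be a positive integer. An $n$-dimensional periodic graph $(\Gamma, L)$ consists of a free abelian group $L \simeq \mathbb{Z}^n$ of rank $n$ and a graph $\Gamma$ with an $L$-action, i.e. $L$-actions on $V_\Gamma$ and $E_\Gamma$ satisfying $s(u(e)) = u(s(e))$, $t(u(e)) = u(t(e))$, $w(u(e)) = w(e)$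 for all $u \in L$, $e \in E_\Gamma$, such that the actions on $V_\Gamma$ and $E_\Gamma$ are free (no non-trivial element of $L$ fixes a vertex or an edge) and the quotient sets $V_\Gamma/L$ and $E_\Gamma/L$ are finite. Modules. For a commutative monoid $M$, an $M$-module is a set with an $M$-action (written additively); an $M$-module $X$ is finitely generated if $X = \bigcup_{x \in X'} (M + x)$ for some finite subset $X' \subset X$. The set $V_\Gamma^d$ is an $L^d$-module via the componentwise action, hence an $N$-module for every submonoid $N \subset L^d$; an $N$-submodule is a subset stable under $N$. Growth series. For a subset $Y \subset V_\Gamma^d$ and $\mathbf{a} = (a_1,\ldots,a_d) \in \mathbb{Z}_{\ge 0}^d$ define $$B_{Y,\mathbf{a}} := \{ (y_1,\ldots,y_d) \in Y \mid d_\Gamma(x_0,y_i) \le a_i \text{ for each } 1 \le i \le d \},$$ $$S_{Y,\mathbf{a}} := \{ (y_1,\ldots,y_d) \in Y \mid d_\Gamma(x_0,y_i) = a_i \text{ for each } 1 \le i \le d \},$$ and, with $\mathbf{z}^{\mathbf{a}} := z_1^{a_1}\cdots z_d^{a_d}$, $$\mathbb{B}_{Y,x_0}(\mathbf{z}) := \sum_{\mathbf{a} \in \mathbb{Z}_{\ge 0}^d} \# B_{Y,\mathbf{a}}\, \mathbf{z}^{\mathbf{a}}, \qquad \mathbb{S}_{Y,x_0}(\mathbf{z}) := \sum_{\mathbf{a} \in \mathbb{Z}_{\ge 0}^d} \# S_{Y,\mathbf{a}}\, \mathbf{z}^{\mathbf{a}}.$$ (These cardinalities are finite.) A formal power series is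 a rational function if it is a quotient $P/Q$ of polynomials in $z_1,\ldots,z_d$ with $Q \ne 0$ (i.e. $Q$ times the series equals $P$). *)

theory Defs
  imports
    "HOL-Algebra.Group_Action"
    "HOL-Algebra.Product_Groups"
    "HOL-Library.Extended_Nat"
    "HOL-Library.Poly_Mapping"
    "Graph_Theory.Arc_Walk"
begin

text \<open>
  A graph is a possibly infinite \<^locale>\<open>wf_digraph\<close>, which allows loops and multiple arcs; its
  source and target maps are \<^const>\<open>tail\<close> and \<^const>\<open>head\<close>. Walks are the walks
  \<^const>\<open>pre_digraph.awalk\<close> of the library, which include the walk of length 0 at each vertex.
  The infimum below is attained unless there is no walk, in which case it is \<open>\<infinity>\<close>.
\<close>

definition weighted_dist :: "('v, 'e) pre_digraph \<Rightarrow> ('e \<Rightarrow> nat) \<Rightarrow> 'v \<Rightarrow> 'v \<Rightarrow> enat" where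
  "weighted_dist \<Gamma> w x y = (INF p \<in> {p. pre_digraph.awalk \<Gamma> x p y}. enat (\<Sum>e\<leftarrow>p. w e))"

text \<open>The group \<open>L\<close> is written multiplicatively, following HOL-Algebra.\<close>

locale periodic_graph =
  wf_digraph \<Gamma> + comm_group L +
  V: group_action L "verts \<Gamma>" actV + E: group_action L "arcs \<Gamma>" actE
  for n :: nat
    and \<Gamma> :: "('v, 'e) pre_digraph"
    and w :: "'e \<Rightarrow> nat"
    and L :: "('l, 'm) monoid_scheme"
    and actV :: "'l \<Rightarrow> 'v \<Rightarrow> 'v"
    and actE :: "'l \<Rightarrow> 'e \<Rightarrow> 'e" +
  assumes dim_pos: "n > 0"
    and rank: "L \<cong> product_group {..<n} (\<lambda>_. integer_group)"
    and weight_pos: "\<And>e. e \<in> arcs \<Gamma> \<Longrightarrow> w e > 0"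
    and tail_act: "\<And>u e. u \<in> carrier L \<Longrightarrow> e \<in> arcs \<Gamma> \<Longrightarrow> tail \<Gamma> (actE u e) = actV u (tail \<Gamma> e)"
    and head_act: "\<And>u e. u \<in> carrier L \<Longrightarrow> e \<in> arcs \<Gamma> \<Longrightarrow> head \<Gamma> (actE u e) = actV u (head \<Gamma> e)"
    and weight_act: "\<And>u e. u \<in> carrier L \<Longrightarrow> e \<in> arcs \<Gamma> \<Longrightarrow> w (actE u e) = w e"
    and free_verts: "\<And>x. x \<in> verts \<Gamma> \<Longrightarrow> stabilizer L actV x = {\<one>\<^bsub>L\<^esub>}"
    and free_arcs: "\<And>e. e \<in> arcs \<Gamma> \<Longrightarrow> stabilizer L actE e = {\<one>\<^bsub>L\<^esub>}"
    and finite_vert_orbits: "finite (orbits L (verts \<Gamma>) actV)"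
    and finite_arc_orbits: "finite (orbits L (arcs \<Gamma>) actE)"

text \<open>
  The number \<open>d\<close> of factors is \<open>CARD('d)\<close> for a finite index type \<open>'d\<close>: the set \<open>V\<^sup>d\<close> is
  \<open>UNIV \<rightarrow> V\<close> and the group \<open>L\<^sup>d\<close> is \<open>product_group UNIV (\<lambda>_. L)\<close>.
\<close>

definition tuple_act :: "('l \<Rightarrow> 'v \<Rightarrow> 'v) \<Rightarrow> ('d \<Rightarrow> 'l) \<Rightarrow> ('d \<Rightarrow> 'v) \<Rightarrow> ('d \<Rightarrow> 'v)" where
  "tuple_act act u y = (\<lambda>i. act (u i) (y i))"

definition fg_submonoid :: "('a, 'm) monoid_scheme \<Rightarrow> 'a set \<Rightarrow> bool" where
  "fg_submonoid G N \<longleftrightarrow>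
    submonoid N G \<and> (\<exists>A. finite A \<and> A \<subseteq> carrier G \<and> N = (\<lambda>H. submonoid H G) hull A)"

definition is_submodule :: "'a set \<Rightarrow> ('a \<Rightarrow> 'x \<Rightarrow> 'x) \<Rightarrow> 'x set \<Rightarrow> 'x set \<Rightarrow> bool" where
  "is_submodule N act X Y \<longleftrightarrow> Y \<subseteq> X \<and> (\<forall>u\<in>N. \<forall>y\<in>Y. act u y \<in> Y)"

definition fg_module :: "'a set \<Rightarrow> ('a \<Rightarrow> 'x \<Rightarrow> 'x) \<Rightarrow> 'x set \<Rightarrow> bool" where
  "fg_module N act Y \<longleftrightarrow>
    (\<exists>X'. finite X' \<and> X' \<subseteq> Y \<and> Y = (\<Union>x\<in>X'. (\<lambda>u. act u x) ` N))"

text \<open>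
  Polynomials over \<open>\<int>\<close> in variables indexed by \<open>'d\<close> have type \<open>('d \<Rightarrow>\<^sub>0 nat) \<Rightarrow>\<^sub>0 int\<close>; formal power
  series are arbitrary coefficient functions on the same exponents.
\<close>

type_synonym 'd power_series = "('d \<Rightarrow>\<^sub>0 nat) \<Rightarrow> int"

definition poly_times_series ::
  "(('d \<Rightarrow>\<^sub>0 nat) \<Rightarrow>\<^sub>0 int) \<Rightarrow> 'd power_series \<Rightarrow> 'd power_series" where
  "poly_times_series Q F = (\<lambda>c. \<Sum>(a, b) | a + b = c. Poly_Mapping.lookup Q a * F b)"

definition is_rational_series :: "'d power_series \<Rightarrow> bool" where
  "is_rational_series F \<longleftrightarrow>
    (\<exists>P Q :: ('d \<Rightarrow>\<^sub>0 nat) \<Rightarrow>\<^sub>0 int. Q \<noteq> 0 \<and> poly_times_series Q F = Poly_Mapping.lookup P)"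

definition ball_set ::
  "('v, 'e) pre_digraph \<Rightarrow> ('e \<Rightarrow> nat) \<Rightarrow> 'v \<Rightarrow> ('d \<Rightarrow> 'v) set \<Rightarrow> ('d \<Rightarrow>\<^sub>0 nat) \<Rightarrow> ('d \<Rightarrow> 'v) set" where
  "ball_set \<Gamma> w x\<^sub>0 Y a =
    {y \<in> Y. \<forall>i. weighted_dist \<Gamma> w x\<^sub>0 (y i) \<le> enat (Poly_Mapping.lookup a i)}"

definition sphere_set ::
  "('v, 'e) pre_digraph \<Rightarrow> ('e \<Rightarrow> nat) \<Rightarrow> 'v \<Rightarrow> ('d \<Rightarrow> 'v) set \<Rightarrow> ('d \<Rightarrow>\<^sub>0 nat) \<Rightarrow> ('d \<Rightarrow> 'v) set" where
  "sphere_set \<Gamma> w x\<^sub>0 Y a =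
    {y \<in> Y. \<forall>i. weighted_dist \<Gamma> w x\<^sub>0 (y i) = enat (Poly_Mapping.lookup a i)}"

text \<open>
  These sets are finite when \<open>\<Gamma>\<close> is a periodic graph and \<open>Y \<subseteq> V\<^sup>d\<close>, since a periodic graph has
  finite out-degrees and positive weights.
\<close>

definition ball_series ::
  "('v, 'e) pre_digraph \<Rightarrow> ('e \<Rightarrow> nat) \<Rightarrow> 'v \<Rightarrow> ('d \<Rightarrow> 'v) set \<Rightarrow> 'd power_series" where
  "ball_series \<Gamma> w x\<^sub>0 Y = (\<lambda>a. int (card (ball_set \<Gamma> w x\<^sub>0 Y a)))"

definition sphere_series ::
  "('v, 'e) pre_digraph \<Rightarrow> ('e \<Rightarrow> nat) \<Rightarrow> 'v \<Rightarrow> ('d \<Rightarrow> 'v) set \<Rightarrow> 'd power_series" where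
  "sphere_series \<Gamma> w x\<^sub>0 Y = (\<lambda>a. int (card (sphere_set \<Gamma> w x\<^sub>0 Y a)))"

end

theory Submission
  imports Defs "HOL-Library.Function_Algebras" "HOL-Library.Product_Plus" "HOL-Library.Set_Algebras"
begin

text \<open>
  The growth series counts, by degree, the points of a semilinear set, that is, of a finite union of
  sets \<open>f + M\<close> with \<open>M\<close> a finitely generated submonoid of a cancellative commutative monoid; and such
  counts, as soon as they are finite, form a rational series.

  \<^emph>\<open>Why balls are semilinear.\<close> Freeness and finiteness of the orbits give coordinates
  \<open>pos\<close> embedding the vertices into \<open>\<int>\<^sup>n \<times> \<int>\<close> so that \<open>L\<close> acts by translations (\<open>equivariant_embedding\<close>).
  The weight and the displacement of an arc depend only on its orbit, so a walk from \<open>x\<close> is the same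
  as a run of the finite quotient graph, whose arcs are labelled by weight and displacement. The
  possible total labels of the runs of a finite automaton form a semilinear set
  (\<open>semilinear_runs\<close>, a commutative form of Kleene's theorem). Adding multiples of \<open>(1, 0)\<close> shows that
  the pairs \<open>(a, pos y)\<close> with \<open>d(x, y) \<le> a\<close> form a semilinear set.

  \<^emph>\<open>Restricting to the submodule.\<close> In coordinates, \<open>Y\<close> is a finite set plus a finitely generated
  monoid. Dickson's lemma shows that imposing such a membership condition on a semilinear set
  leaves a semilinear set (\<open>fg_subset_vimage\<close>, Gordan's lemma for modules), so the
  tuples \<open>(a\<^sub>i, pos y\<^sub>i)\<close> with \<open>y \<in> Y\<close> and \<open>d(x, y\<^sub>i) \<le> a\<^sub>i\<close> form a semilinear set too.

  \<^emph>\<open>Why counting is rational.\<close> This is the argument of Hilbert and Serre carried out with sets. If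
  \<open>X = F + M\<close> where \<open>M\<close> is generated by \<open>p\<close> and \<open>P\<close>, then \<open>X\<close> is the union of \<open>A = F + \<langle>P\<rangle>\<close> and of the
  translate \<open>p + X\<close>. Hence \<open>(1 - z\<^bsup>deg p\<^esup>)\<close> times the series of \<open>X\<close> is the series of \<open>A\<close> minus that of
  \<open>A \<inter> (p + X)\<close>, and the latter set is again finitely generated over \<open>\<langle>P\<rangle>\<close> because submodules
  of finitely generated modules are. Induction on the number of generators gives rationality for one
  module (\<open>counting_series_fg_rational\<close>), inclusion-exclusion gives it for finite unions.

  Finally, the sphere series is the ball series multiplied by all \<open>1 - z\<^sub>i\<close>.
\<close>

section \<open>Finitely generated monoids and their modules\<close>

inductive_set monoid_span :: "'a::comm_monoid_add set \<Rightarrow> 'a set" for P where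
  monoid_span_zero: "0 \<in> monoid_span P"
| monoid_span_step: "p \<in> P \<Longrightarrow> x \<in> monoid_span P \<Longrightarrow> p + x \<in> monoid_span P"

lemma monoid_span_add: "x \<in> monoid_span P \<Longrightarrow> y \<in> monoid_span P \<Longrightarrow> x + y \<in> monoid_span P"
  by (induction rule: monoid_span.induct) (auto simp: add.assoc intro: monoid_span.intros)

lemma monoid_span_base: "p \<in> P \<Longrightarrow> p \<in> monoid_span P"
  using monoid_span_step[OF _ monoid_span_zero] by force

lemma monoid_span_least:
  assumes "P \<subseteq> M" "0 \<in> M" "\<And>x y. x \<in> M \<Longrightarrow> y \<in> M \<Longrightarrow> x + y \<in> M"
  shows "monoid_span P \<subseteq> M"
proof
  show "x \<in> M" if "x \<in> monoid_span P" for x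
    using that by induction (use assms in auto)
qed

lemma monoid_span_mono: "P \<subseteq> Q \<Longrightarrow> monoid_span P \<subseteq> monoid_span Q"
  by (rule monoid_span_least) (auto intro: monoid_span_base monoid_span_zero monoid_span_add)

lemma monoid_span_empty [simp]: "monoid_span {} = {0}"
  by (auto elim: monoid_span.cases intro: monoid_span_zero)

lemma monoid_span_Un: "monoid_span (P \<union> Q) = monoid_span P + monoid_span Q"
proof
  show "monoid_span (P \<union> Q) \<subseteq> monoid_span P + monoid_span Q"
  proof (rule monoid_span_least)
    have "p + 0 \<in> monoid_span P + monoid_span Q" if "p \<in> P" for p
      using that by (intro set_plus_intro monoid_span_base monoid_span_zero)
    moreover have "0 + q \<in> monoid_span P + monoid_span Q" if "q \<in> Q" for q
      using that by (intro set_plus_intro monoid_span_base monoid_span_zero)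
    ultimately show "P \<union> Q \<subseteq> monoid_span P + monoid_span Q" by auto
    have "0 + 0 \<in> monoid_span P + monoid_span Q"
      by (intro set_plus_intro monoid_span_zero)
    then show "0 \<in> monoid_span P + monoid_span Q" by simp
  next
    fix x y assume "x \<in> monoid_span P + monoid_span Q" "y \<in> monoid_span P + monoid_span Q"
    then obtain a b c d where *: "x = a + b" "y = c + d" "a \<in> monoid_span P" "c \<in> monoid_span P"
      "b \<in> monoid_span Q" "d \<in> monoid_span Q"
      by (elim set_plus_elim)
    then have "(a + c) + (b + d) \<in> monoid_span P + monoid_span Q"
      by (intro set_plus_intro monoid_span_add)
    then show "x + y \<in> monoid_span P + monoid_span Q"
      using * by (simp add: ac_simps)
  qed
  show "monoid_span P + monoid_span Q \<subseteq> monoid_span (P \<union> Q)"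
    using monoid_span_mono[of P "P \<union> Q"] monoid_span_mono[of Q "P \<union> Q"]
    by (auto elim!: set_plus_elim intro: monoid_span_add)
qed

lemma monoid_span_image:
  assumes "h 0 = 0" "\<And>x y. h (x + y) = h x + h y"
  shows "h ` monoid_span P = monoid_span (h ` P)"
proof
  show "monoid_span (h ` P) \<subseteq> h ` monoid_span P"
  proof (rule monoid_span_least)
    show "0 \<in> h ` monoid_span P"
      using assms(1) monoid_span_zero by force
    show "x + y \<in> h ` monoid_span P" if "x \<in> h ` monoid_span P" "y \<in> h ` monoid_span P" for x y
      using that by (auto simp flip: assms(2) intro: monoid_span_add)
  qed (auto intro: monoid_span_base)
  show "h ` monoid_span P \<subseteq> monoid_span (h ` P)"
  proof clarify
    show "h x \<in> monoid_span (h ` P)" if "x \<in> monoid_span P" for x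
      using that by induction (auto simp: assms intro: monoid_span.intros)
  qed
qed

primrec nat_scale :: "nat \<Rightarrow> 'a::comm_monoid_add \<Rightarrow> 'a" where
  "nat_scale 0 p = 0"
| "nat_scale (Suc k) p = p + nat_scale k p"

lemma nat_scale_add: "nat_scale (k + l) p = nat_scale k p + nat_scale l p"
  by (induction k) (auto simp: ac_simps)

lemma nat_scale_in_monoid_span: "p \<in> monoid_span P \<Longrightarrow> nat_scale k p \<in> monoid_span P"
  by (induction k) (auto intro: monoid_span_zero monoid_span_add)

text \<open>
  Writing the elements of a finitely generated monoid as values of \<open>lincomb P\<close> reduces
  questions about it to the exponent vectors, where Dickson's lemma applies.
\<close>

definition lincomb :: "'a set \<Rightarrow> ('a \<Rightarrow> nat) \<Rightarrow> 'a::comm_monoid_add" where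
  "lincomb P k = (\<Sum>p\<in>P. nat_scale (k p) p)"

lemma lincomb_zero: "lincomb P (\<lambda>p. 0) = 0"
  by (simp add: lincomb_def)

lemma lincomb_add: "lincomb P (\<lambda>p. k p + l p) = lincomb P k + lincomb P l"
  by (simp add: lincomb_def nat_scale_add sum.distrib)

lemma lincomb_plus: "lincomb P (k + l) = lincomb P k + lincomb P l"
  by (simp add: plus_fun_def lincomb_add)

lemma lincomb_in_monoid_span: "lincomb P k \<in> monoid_span P"
  unfolding lincomb_def
proof (induction P rule: infinite_finite_induct)
  case (insert p P)
  have "nat_scale (k p) p + (\<Sum>q\<in>P. nat_scale (k q) q) \<in> monoid_span (insert p P)"
    using insert.IH monoid_span_mono[of P "insert p P"]
    by (auto intro!: monoid_span_add[OF nat_scale_in_monoid_span[OF monoid_span_base]])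
  then show ?case using insert by simp
qed (auto intro: monoid_span_zero)

lemma monoid_span_eq_lincomb:
  assumes "finite P" "x \<in> monoid_span P"
  shows "\<exists>k. x = lincomb P k \<and> (\<forall>p. p \<notin> P \<longrightarrow> k p = 0)"
  using assms(2)
proof induction
    case monoid_span_zero
    then show ?case using lincomb_zero[of P] by metis
  next
    case (monoid_span_step p x)
    then obtain k where k: "x = lincomb P k" "\<forall>p. p \<notin> P \<longrightarrow> k p = 0" by auto
    have "lincomb P (\<lambda>q. if q = p then 1 else 0) = (\<Sum>q\<in>P. if q = p then p else 0)"
      unfolding lincomb_def by (rule sum.cong) auto
    also have "\<dots> = p"
      using monoid_span_step assms(1) by simp
    finally have "p + x = lincomb P (\<lambda>q. (if q = p then 1 else 0) + k q)"
      using k by (simp only: lincomb_add)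
    then show ?case
      using k monoid_span_step by (intro exI[of _ "\<lambda>q. (if q = p then 1 else 0) + k q"]) auto
qed

text \<open>
  Every set of exponent vectors has finitely many elements below which no others are needed. For a
  new coordinate \<open>j\<close>, a finite set \<open>B\<close> that works for the old coordinates also handles all
  vectors whose \<open>j\<close>-th entry is at least the maximum \<open>m\<close> over \<open>B\<close>; the finitely many values
  below \<open>m\<close> are fixed one at a time.
\<close>

lemma dickson:
  fixes S :: "('i \<Rightarrow> nat) set"
  assumes "finite I"
  shows "\<exists>B. finite B \<and> B \<subseteq> S \<and> (\<forall>x\<in>S. \<exists>b\<in>B. \<forall>i\<in>I. b i \<le> x i)"
  using assms
proof (induction I arbitrary: S rule: finite_induct)
  case empty
  show ?case
  proof (cases "S = {}")
    case False
    then obtain s where "s \<in> S" by auto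
    then show ?thesis by (intro exI[of _ "{s}"]) auto
  qed auto
next
  case (insert j I)
  obtain B where B: "finite B" "B \<subseteq> S" "\<forall>x\<in>S. \<exists>b\<in>B. \<forall>i\<in>I. b i \<le> x i"
    using insert.IH[of S] by auto
  define m where "m = Max ((\<lambda>b. b j) ` B)"
  have m: "b j \<le> m" if "b \<in> B" for b
    using that B(1) by (simp add: m_def)
  have "\<forall>k. \<exists>C. finite C \<and> C \<subseteq> {x\<in>S. x j = k} \<and>
      (\<forall>x\<in>{x\<in>S. x j = k}. \<exists>b\<in>C. \<forall>i\<in>I. b i \<le> x i)"
    using insert.IH by blast
  from choice[OF this] obtain C where C': "\<forall>k. finite (C k) \<and> C k \<subseteq> {x\<in>S. x j = k} \<and>
      (\<forall>x\<in>{x\<in>S. x j = k}. \<exists>b\<in>C k. \<forall>i\<in>I. b i \<le> x i)" ..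
  have C: "finite (C k)" "C k \<subseteq> {x\<in>S. x j = k}"
    "x \<in> S \<Longrightarrow> x j = k \<Longrightarrow> \<exists>b\<in>C k. \<forall>i\<in>I. b i \<le> x i" for k x
    using C' by blast+
  let ?B = "B \<union> (\<Union>k<m. C k)"
  have "\<exists>b\<in>?B. \<forall>i\<in>insert j I. b i \<le> x i" if "x \<in> S" for x
  proof (cases "x j < m")
    case True
    obtain b where b: "b \<in> C (x j)" "\<forall>i\<in>I. b i \<le> x i"
      using C(3)[OF \<open>x \<in> S\<close> refl] by blast
    moreover have "b j = x j" using b(1) C(2)[of "x j"] by blast
    ultimately show ?thesis using True by (intro bexI[of _ b]) auto
  next
    case False
    obtain b where b: "b \<in> B" "\<forall>i\<in>I. b i \<le> x i" using B(3) \<open>x \<in> S\<close> by blast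
    moreover have "b j \<le> x j" using m[OF b(1)] False by linarith
    ultimately show ?thesis by (intro bexI[of _ b]) auto
  qed
  moreover have "finite ?B" using B C by simp
  moreover have "?B \<subseteq> S" using B(2) C(2) by blast
  ultimately show ?case by (intro exI[of _ ?B]) simp
qed

lemma dickson_le:
  fixes S :: "('i \<Rightarrow> nat) set"
  assumes "finite I" "\<And>x i. x \<in> S \<Longrightarrow> i \<notin> I \<Longrightarrow> x i = 0"
  shows "\<exists>B. finite B \<and> B \<subseteq> S \<and> (\<forall>x\<in>S. \<exists>b\<in>B. b \<le> x)"
proof -
  obtain B where B: "finite B" "B \<subseteq> S" "\<forall>x\<in>S. \<exists>b\<in>B. \<forall>i\<in>I. b i \<le> x i"
    using dickson[OF assms(1), of S] by blast
  have "\<exists>b\<in>B. b \<le> x" if "x \<in> S" for x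
  proof -
    obtain b where b: "b \<in> B" "\<forall>i\<in>I. b i \<le> x i" using B(3) \<open>x \<in> S\<close> by blast
    have "b i \<le> x i" for i
      using b assms(2)[of b i] B(2) by (cases "i \<in> I") auto
    then show ?thesis using b(1) by (auto simp: le_fun_def)
  qed
  with B(1,2) show ?thesis by (intro exI[of _ B]) simp
qed

lemma nat_fun_add_diff: "b \<le> x \<Longrightarrow> x = b + (x - b)" for x :: "'i \<Rightarrow> nat"
  by (auto simp: le_fun_def)

text \<open>
  A monoid of exponent vectors that is closed under the subtractions possible in it, such as the
  solutions of a homogeneous linear equation, is generated by the finitely many minimal
  nonzero elements that Dickson's lemma provides: subtracting one of them lowers the coordinate sum.
\<close>

lemma gordan:
  fixes S :: "('i \<Rightarrow> nat) set"
  assumes I: "finite I" "\<And>x i. x \<in> S \<Longrightarrow> i \<notin> I \<Longrightarrow> x i = 0"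
    and zero: "0 \<in> S" and add: "\<And>x y. x \<in> S \<Longrightarrow> y \<in> S \<Longrightarrow> x + y \<in> S"
    and diff: "\<And>x y. x \<in> S \<Longrightarrow> y \<in> S \<Longrightarrow> x \<le> y \<Longrightarrow> y - x \<in> S"
  obtains B where "finite B" "S = monoid_span B"
proof -
  have "\<exists>B. finite B \<and> B \<subseteq> S - {0} \<and> (\<forall>x\<in>S - {0}. \<exists>b\<in>B. b \<le> x)"
    by (rule dickson_le[OF I(1)]) (use I(2) in simp)
  then obtain B where B: "finite B" "B \<subseteq> S - {0}" "\<forall>x\<in>S - {0}. \<exists>b\<in>B. b \<le> x"
    by (elim exE conjE)
  have "x \<in> monoid_span B" if "x \<in> S" for x
    using that
  proof (induction "\<Sum>i\<in>I. x i" arbitrary: x rule: less_induct)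
    case less
    show ?case
    proof (cases "x = 0")
      case False
      then obtain b where b: "b \<in> B" "b \<le> x" using B(3) less.prems by blast
      have "b \<noteq> 0" "b \<in> S" using b B by auto
      then obtain i where "b i \<noteq> 0" by (auto simp: fun_eq_iff)
      then have i: "i \<in> I" "b i \<noteq> 0" using I(2)[OF \<open>b \<in> S\<close>, of i] by auto
      have "(\<Sum>i\<in>I. (x - b) i) < (\<Sum>i\<in>I. x i)"
      proof (rule sum_strict_mono_ex1[OF I(1)])
        have "b i \<le> x i" using b(2) by (simp add: le_fun_def)
        with i show "\<exists>a\<in>I. (x - b) a < x a" by (intro bexI[of _ i]) auto
      qed auto
      then have "x - b \<in> monoid_span B"
        by (rule less.hyps) (rule diff[OF \<open>b \<in> S\<close> less.prems b(2)])
      then show ?thesis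
        using monoid_span_step[OF b(1)] nat_fun_add_diff[OF b(2)] by metis
    qed (simp add: monoid_span_zero)
  qed
  moreover have "monoid_span B \<subseteq> S"
    by (rule monoid_span_least) (use B zero add in auto)
  ultimately have "S = monoid_span B" by blast
  then show thesis by (rule that[OF B(1)])
qed

text \<open>The subsets that are finitely generated modules over some finitely generated submonoid.\<close>

definition fg_subset :: "'a::comm_monoid_add set \<Rightarrow> bool" where
  "fg_subset X \<longleftrightarrow> (\<exists>F P. finite F \<and> finite P \<and> X = F + monoid_span P)"

text \<open>
  The Noetherian property, from Dickson's lemma applied, for each generator \<open>f\<close>, to the exponent
  vectors that lead from \<open>f\<close> into the submodule.
\<close>

lemma submodule_fg:
  fixes F P X :: "'a::comm_monoid_add set"
  assumes "finite F" "finite P" and sub: "X \<subseteq> F + monoid_span P"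
    and stable: "\<And>x m. x \<in> X \<Longrightarrow> m \<in> monoid_span P \<Longrightarrow> x + m \<in> X"
  obtains F' where "finite F'" "X = F' + monoid_span P"
proof -
  define S where "S f = {k. (\<forall>p. p \<notin> P \<longrightarrow> k p = 0) \<and> f + lincomb P k \<in> X}" for f
  have "\<exists>B. finite B \<and> B \<subseteq> S f \<and> (\<forall>k\<in>S f. \<exists>b\<in>B. b \<le> k)" for f
    by (rule dickson_le[OF assms(2), of "S f"]) (auto simp: S_def)
  then have "\<forall>f. \<exists>B. finite B \<and> B \<subseteq> S f \<and> (\<forall>k\<in>S f. \<exists>b\<in>B. b \<le> k)" ..
  from choice[OF this] obtain B where
    B': "\<forall>f. finite (B f) \<and> B f \<subseteq> S f \<and> (\<forall>k\<in>S f. \<exists>b\<in>B f. b \<le> k)" ..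
  then have B: "\<And>f. finite (B f)" "\<And>f. B f \<subseteq> S f"
    "\<And>f k. k \<in> S f \<Longrightarrow> \<exists>b\<in>B f. b \<le> k" by auto
  let ?F = "\<Union>f\<in>F. (\<lambda>b. f + lincomb P b) ` B f"
  have "X = ?F + monoid_span P"
  proof
    show "X \<subseteq> ?F + monoid_span P"
    proof
      fix x assume x: "x \<in> X"
      then obtain f m where "f \<in> F" "m \<in> monoid_span P" "x = f + m"
        using sub by (auto simp: set_plus_def)
      moreover then obtain k where "m = lincomb P k" "\<forall>p. p \<notin> P \<longrightarrow> k p = 0"
        using monoid_span_eq_lincomb[OF assms(2)] by meson
      ultimately have k: "f \<in> F" "x = f + lincomb P k" "k \<in> S f"
        using x by (auto simp: S_def)
      then obtain b where b: "b \<in> B f" "b \<le> k" using B(3) by blast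
      have "lincomb P k = lincomb P b + lincomb P (k - b)"
        using nat_fun_add_diff[OF b(2)] lincomb_plus[of P b "k - b"] by metis
      then have "x = (f + lincomb P b) + lincomb P (k - b)"
        using k by (simp add: add.assoc)
      then show "x \<in> ?F + monoid_span P"
        using b k(1) lincomb_in_monoid_span by blast
    qed
    have "f + lincomb P b \<in> X" if "b \<in> B f" for f b
      using B(2)[of f] that by (auto simp: S_def)
    then show "?F + monoid_span P \<subseteq> X"
      using stable by (auto simp: set_plus_def)
  qed
  then show thesis using that[of ?F] assms(1) B(1) by auto
qed

text \<open>
  The pairs of exponent vectors \<open>(k, k')\<close> with \<open>h (f + P k) = g + Q k'\<close> are the solutions of an
  inhomogeneous linear equation. Dickson's lemma yields finitely many minimal ones, and by
  cancellation the difference of two comparable solutions solves the homogeneous equation, whose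
  solutions form a finitely generated monoid by \<open>gordan\<close>. This monoid, mapped to its first
  component, is one that works for all \<open>f\<close> and \<open>g\<close>.
\<close>

lemma fg_subset_vimage:
  fixes h :: "'a::cancel_comm_monoid_add \<Rightarrow> 'b::cancel_comm_monoid_add"
  assumes h: "h 0 = 0" "\<And>x y. h (x + y) = h x + h y"
    and "fg_subset X" "fg_subset Z"
  shows "fg_subset {x \<in> X. h x \<in> Z}"
proof -
  obtain F P where X: "finite F" "finite P" "X = F + monoid_span P"
    using assms(3) by (auto simp: fg_subset_def)
  obtain G Q where Z: "finite G" "finite Q" "Z = G + monoid_span Q"
    using assms(4) by (auto simp: fg_subset_def)
  define I where "I = P <+> Q"
  have I: "finite I" using X Z by (simp add: I_def)
  \<comment> \<open>An exponent vector on the disjoint union \<open>I\<close> encodes a pair: \<open>l\<close> evaluates its part on \<open>P\<close>,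
     and \<open>r\<close> its part on \<open>Q\<close>.\<close>
  define l :: "('a + 'b \<Rightarrow> nat) \<Rightarrow> 'a" where "l k = lincomb P (\<lambda>p. k (Inl p))" for k
  define r :: "('a + 'b \<Rightarrow> nat) \<Rightarrow> 'b" where "r k = lincomb Q (\<lambda>q. k (Inr q))" for k
  have l: "l 0 = 0" "l (x + y) = l x + l y" "l x \<in> monoid_span P" for x y
    by (auto simp: l_def lincomb_zero lincomb_add lincomb_in_monoid_span)
  have r: "r 0 = 0" "r (x + y) = r x + r y" "r x \<in> monoid_span Q" for x y
    by (auto simp: r_def lincomb_zero lincomb_add lincomb_in_monoid_span)
  define S where "S f g = {k. (\<forall>i. i \<notin> I \<longrightarrow> k i = 0) \<and> h (f + l k) = g + r k}" for f g
  have diff: "y - x \<in> S 0 0" if "x \<in> S f g" "y \<in> S f g" "x \<le> y" for x y f g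
  proof -
    have "y = x + (y - x)" using that(3) by (rule nat_fun_add_diff)
    moreover have "h (l y) + h f = g + r y"
      using that(2) by (simp add: S_def h add.commute)
    ultimately have "h (l (x + (y - x))) + h f = g + r (x + (y - x))"
      by metis
    then have "(h f + h (l x)) + h (l (y - x)) = (g + r x) + r (y - x)"
      by (simp only: h l r) (simp add: ac_simps)
    then show ?thesis using that by (auto simp: S_def h)
  qed
  have S_sub: "k \<in> S f g \<Longrightarrow> i \<notin> I \<Longrightarrow> k i = 0" for k f g i
    by (auto simp: S_def)
  have S_zero: "0 \<in> S 0 0" by (simp add: S_def l r h)
  have S_add: "x \<in> S f g \<Longrightarrow> y \<in> S 0 0 \<Longrightarrow> x + y \<in> S f g" for x y f g
    by (simp add: S_def h l r flip: add.assoc)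
  obtain B where B: "finite B" "S 0 0 = monoid_span B"
    by (rule gordan[OF I, of "S 0 0"])
      (auto intro: S_sub S_zero S_add diff)
  have "\<exists>C. finite C \<and> C \<subseteq> S f g \<and> (\<forall>k\<in>S f g. \<exists>b\<in>C. b \<le> k)" for f g
    by (rule dickson_le[OF I, of "S f g"]) (auto simp: S_def)
  then have "\<forall>fg. \<exists>C. finite C \<and> C \<subseteq> S (fst fg) (snd fg) \<and>
      (\<forall>k\<in>S (fst fg) (snd fg). \<exists>b\<in>C. b \<le> k)" by blast
  from choice[OF this] obtain C where C': "\<forall>fg. finite (C fg) \<and> C fg \<subseteq> S (fst fg) (snd fg) \<and>
      (\<forall>k\<in>S (fst fg) (snd fg). \<exists>b\<in>C fg. b \<le> k)" ..
  have C: "finite (C (f, g))" "C (f, g) \<subseteq> S f g" "k \<in> S f g \<Longrightarrow> \<exists>b\<in>C (f, g). b \<le> k" for f g k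
    using C'[rule_format, of "(f, g)"] by auto
  let ?F = "\<Union>f\<in>F. \<Union>g\<in>G. (\<lambda>k. f + l k) ` C (f, g)"
  have "{x \<in> X. h x \<in> Z} = ?F + monoid_span (l ` B)"
  proof
    show "{x \<in> X. h x \<in> Z} \<subseteq> ?F + monoid_span (l ` B)"
    proof clarify
      fix x assume "x \<in> X" "h x \<in> Z"
      then obtain f m g m' where x: "x = f + m" "h x = g + m'" "f \<in> F" "g \<in> G"
        "m \<in> monoid_span P" "m' \<in> monoid_span Q"
        unfolding X Z by (auto simp: set_plus_def)
      obtain k where k: "m = lincomb P k" "\<forall>p. p \<notin> P \<longrightarrow> k p = 0"
        using monoid_span_eq_lincomb[OF X(2) x(5)] by auto
      obtain k' where k': "m' = lincomb Q k'" "\<forall>q. q \<notin> Q \<longrightarrow> k' q = 0"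
        using monoid_span_eq_lincomb[OF Z(2) x(6)] by auto
      define t where "t = case_sum k k'"
      have t: "l t = m" "r t = m'"
        by (auto simp: l_def r_def k k' t_def)
      have "t i = 0" if "i \<notin> I" for i
        using that k(2) k'(2) by (cases i) (auto simp: I_def t_def)
      then have "t \<in> S f g"
        using t x by (simp add: S_def)
      then obtain b where b: "b \<in> C (f, g)" "b \<le> t" using C(3) by blast
      then have "t - b \<in> monoid_span B"
        using diff[of b f g t] \<open>t \<in> S f g\<close> C(2) B(2) by blast
      then have "l (t - b) \<in> monoid_span (l ` B)"
        using monoid_span_image[of l B] l by blast
      moreover have "x = (f + l b) + l (t - b)"
        using nat_fun_add_diff[OF b(2)] l(2)[of b "t - b"] x(1) t(1) by (metis add.assoc)
      ultimately show "x \<in> ?F + monoid_span (l ` B)"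
        using b x by blast
    qed
    show "?F + monoid_span (l ` B) \<subseteq> {x \<in> X. h x \<in> Z}"
    proof
      fix x assume "x \<in> ?F + monoid_span (l ` B)"
      then obtain f g k m where x: "f \<in> F" "g \<in> G" "k \<in> C (f, g)" "m \<in> l ` monoid_span B" "x = f + l k + m"
        using monoid_span_image[of l B] l by (auto simp: set_plus_def)
      then obtain k' where k': "k' \<in> S 0 0" "m = l k'" using B by auto
      then have "k + k' \<in> S f g" using S_add x C(2) by blast
      moreover have "x = f + l (k + k')" using x k' l by (simp add: add.assoc)
      ultimately have "h x = g + r (k + k')" by (simp add: S_def)
      then have "h x \<in> Z"
        using set_plus_intro[OF x(2) r(3)] Z(3) by simp
      moreover have "x \<in> X"
        using set_plus_intro[OF x(1) l(3)] X(3) \<open>x = f + l (k + k')\<close> by simp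
      ultimately show "x \<in> {x \<in> X. h x \<in> Z}" by simp
    qed
  qed
  moreover have "finite ?F" using X Z C by auto
  ultimately show ?thesis
    unfolding fg_subset_def using B(1) by blast
qed

lemma fg_subset_Int:
  fixes X Z :: "'a::cancel_comm_monoid_add set"
  shows "fg_subset X \<Longrightarrow> fg_subset Z \<Longrightarrow> fg_subset (X \<inter> Z)"
  using fg_subset_vimage[of "\<lambda>x. x" X Z] by (simp add: Int_def)

section \<open>Semilinear sets\<close>

text \<open>
  Finite unions of translates of finitely generated monoids; the inductive form gives
  closure properties by rule induction on one translate at a time.
\<close>

inductive semilinear :: "'a::comm_monoid_add set \<Rightarrow> bool" where
  semilinear_empty: "semilinear {}"
| semilinear_insert: "finite P \<Longrightarrow> semilinear X \<Longrightarrow> semilinear (({f} + monoid_span P) \<union> X)"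

lemma semilinear_linear: "finite P \<Longrightarrow> semilinear ({f} + monoid_span P)"
  using semilinear_insert[OF _ semilinear_empty] by force

lemma semilinear_Un: "semilinear X \<Longrightarrow> semilinear Z \<Longrightarrow> semilinear (X \<union> Z)"
  by (induction rule: semilinear.induct) (auto simp: Un_assoc intro: semilinear.intros)

lemma semilinear_UN:
  assumes "finite J" "\<And>j. j \<in> J \<Longrightarrow> semilinear (X j)"
  shows "semilinear (\<Union>j\<in>J. X j)"
  using assms by (induction) (auto intro: semilinear_Un semilinear_empty)

lemma semilinear_fg_subset: "fg_subset X \<Longrightarrow> semilinear X"
proof -
  assume "fg_subset X"
  then obtain F P where "finite F" "finite P" "X = F + monoid_span P" by (auto simp: fg_subset_def)
  moreover have "F + monoid_span P = (\<Union>f\<in>F. {f} + monoid_span P)" by (auto simp: set_plus_def)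
  ultimately show ?thesis using semilinear_UN semilinear_linear by metis
qed

lemma semilinear_singleton: "semilinear {x}"
  using semilinear_linear[of "{}" x] by (simp add: set_plus_def)

lemma set_plus_Un_distrib: "(A \<union> B) + C = (A + C) \<union> (B + C)" "C + (A \<union> B) = (C + A) \<union> (C + B)"
  by (auto simp: set_plus_def)

lemma set_plus_empty [simp]: "{} + C = {}" "C + {} = {}"
  by (auto simp: set_plus_def)

lemma semilinear_plus:
  assumes "semilinear X" "semilinear Z" shows "semilinear (X + Z)"
  using assms
proof (induction rule: semilinear.induct)
  case (semilinear_insert P X f)
  have "semilinear ({f} + monoid_span P + Z)"
    using semilinear_insert.prems
  proof (induction rule: semilinear.induct)
    case (semilinear_insert Q Z g)
    have "{f} + monoid_span P + ({g} + monoid_span Q) = {f + g} + monoid_span (P \<union> Q)"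
      by (simp add: monoid_span_Un set_plus_def) (force simp: ac_simps)
    then show ?case
      using semilinear_insert \<open>finite P\<close>
      by (auto simp: set_plus_Un_distrib intro!: semilinear_Un semilinear_linear)
  qed (simp add: semilinear_empty)
  then show ?case
    using semilinear_insert by (simp add: set_plus_Un_distrib semilinear_Un)
qed (simp add: semilinear_empty)

lemma singleton_plus: "{f} + M = (\<lambda>m. f + m) ` M"
  by (auto simp: set_plus_def)

lemma semilinear_image:
  assumes "h 0 = 0" "\<And>x y. h (x + y) = h x + h y" "semilinear X"
  shows "semilinear (h ` X)"
  using assms(3)
proof (induction rule: semilinear.induct)
  case (semilinear_insert P X f)
  have "h ` ({f} + monoid_span P) = {h f} + monoid_span (h ` P)"
    by (simp add: singleton_plus image_image assms(1,2) flip: monoid_span_image)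
  then show ?case
    using semilinear_insert by (auto simp: image_Un intro!: semilinear_Un semilinear_linear)
qed (simp add: semilinear_empty)

text \<open>
  Commutativity makes the star of a semilinear set semilinear: the star of a union is the sum of the
  stars, and a nonempty sum of elements of \<open>f + \<langle>P\<rangle>\<close> is \<open>f\<close> plus an element of the monoid
  generated by \<open>f\<close> and \<open>P\<close>.
\<close>

lemma semilinear_monoid_span:
  assumes "semilinear X" shows "semilinear (monoid_span X)"
  using assms
proof (induction rule: semilinear.induct)
  case (semilinear_insert P X f)
  have "monoid_span ({f} + monoid_span P) = {0} \<union> ({f} + monoid_span (insert f P))" (is "?l = ?r")
  proof
    show "?l \<subseteq> ?r"
    proof (rule monoid_span_least)
      show "{f} + monoid_span P \<subseteq> ?r" using monoid_span_mono[of P "insert f P"] by (auto simp: singleton_plus)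
    next
      fix x y assume "x \<in> ?r" "y \<in> ?r"
      moreover have "f + a + (f + b) \<in> {f} + monoid_span (insert f P)"
        if "a \<in> monoid_span (insert f P)" "b \<in> monoid_span (insert f P)" for a b
        unfolding singleton_plus add.assoc[of f]
        using that by (auto intro!: imageI monoid_span_add intro: monoid_span_base)
      ultimately show "x + y \<in> ?r" by (auto simp: singleton_plus)
    qed auto
    have "f + m \<in> ?l" if m_in: "m \<in> monoid_span (insert f P)" for m
    proof -
      obtain a b where m: "m = a + b" "a \<in> monoid_span {f}" "b \<in> monoid_span P"
        using m_in monoid_span_Un[of "{f}" P] by (auto elim: set_plus_elim)
      have "f + 0 \<in> {f} + monoid_span P" by (intro set_plus_intro monoid_span_zero) simp
      then have "a \<in> ?l" using m(2) monoid_span_mono[of "{f}" "{f} + monoid_span P"] by auto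
      moreover have "f + b \<in> ?l" using m(3) by (auto intro!: monoid_span_base[of "f + b"])
      ultimately have "a + (f + b) \<in> ?l" by (rule monoid_span_add)
      then show ?thesis using m(1) by (simp add: ac_simps)
    qed
    then show "?r \<subseteq> ?l" by (auto simp: singleton_plus monoid_span_zero)
  qed
  moreover have "semilinear ?r"
    using semilinear_insert by (intro semilinear_Un semilinear_singleton semilinear_linear) simp
  ultimately have "semilinear (monoid_span ({f} + monoid_span P))" by simp
  then show ?case
    using semilinear_insert.IH unfolding monoid_span_Un by (rule semilinear_plus)
qed (simp add: semilinear_singleton)


text \<open>
  The set of functions into \<open>X\<close> is the sum, over the coordinates, of the copies of \<open>X\<close> placed in one
  coordinate.
\<close>

lemma semilinear_funs:
  fixes X :: "'a::comm_monoid_add set"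
  assumes "semilinear X"
  shows "semilinear {f :: 'd::finite \<Rightarrow> 'a. \<forall>i. f i \<in> X}"
proof -
  define S where "S I = {f :: 'd \<Rightarrow> 'a. (\<forall>i\<in>I. f i \<in> X) \<and> (\<forall>i. i \<notin> I \<longrightarrow> f i = 0)}" for I
  have "semilinear (S I)" for I
    using finite[of I]
  proof induction
    case empty
    have "S {} = {0}" by (auto simp: S_def)
    then show ?case by (simp add: semilinear_singleton)
  next
    case (insert j I)
    define e :: "'a \<Rightarrow> 'd \<Rightarrow> 'a" where "e x = (\<lambda>i. if i = j then x else 0)" for x
    have e: "semilinear (e ` X)"
      by (rule semilinear_image[OF _ _ assms]) (auto simp: e_def)
    have "S (insert j I) = S I + e ` X"
    proof
      show "S (insert j I) \<subseteq> S I + e ` X"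
      proof
        fix f assume f: "f \<in> S (insert j I)"
        have "f = (\<lambda>i. if i = j then 0 else f i) + e (f j)"
          by (auto simp: e_def)
        moreover have "(\<lambda>i. if i = j then 0 else f i) \<in> S I"
          using f insert.hyps by (auto simp: S_def)
        moreover have "e (f j) \<in> e ` X" using f by (auto simp: S_def)
        ultimately show "f \<in> S I + e ` X" by (metis set_plus_intro)
      qed
      show "S I + e ` X \<subseteq> S (insert j I)"
        using insert.hyps by (auto simp: S_def e_def elim!: set_plus_elim)
    qed
    then show ?case using insert.IH e by (simp add: semilinear_plus)
  qed
  from this[of UNIV] show ?thesis by (simp add: S_def)
qed

lemma semilinear_vimage:
  fixes h :: "'a::cancel_comm_monoid_add \<Rightarrow> 'b::cancel_comm_monoid_add"
  assumes h: "h 0 = 0" "\<And>x y. h (x + y) = h x + h y"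
    and "semilinear X" "fg_subset Z"
  shows "semilinear {x \<in> X. h x \<in> Z}"
  using assms(3)
proof (induction rule: semilinear.induct)
  case (semilinear_insert P X f)
  have "fg_subset ({f} + monoid_span P)" using semilinear_insert by (auto simp: fg_subset_def)
  then have "semilinear {x \<in> {f} + monoid_span P. h x \<in> Z}"
    using fg_subset_vimage[OF h _ assms(4)] semilinear_fg_subset by blast
  moreover have "{x \<in> ({f} + monoid_span P) \<union> X. h x \<in> Z} =
      {x \<in> {f} + monoid_span P. h x \<in> Z} \<union> {x \<in> X. h x \<in> Z}" by blast
  ultimately show ?case using semilinear_insert.IH by (simp only: semilinear_Un)
qed (simp add: semilinear_empty)

section \<open>Labels of runs of a finite automaton\<close>

inductive run :: "('q \<times> 'a::comm_monoid_add \<times> 'q) set \<Rightarrow> 'q \<Rightarrow> 'a \<Rightarrow> 'q \<Rightarrow> bool" for T where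
  run_Nil: "run T q 0 q"
| run_Cons: "(p, a, q) \<in> T \<Longrightarrow> run T q x r \<Longrightarrow> run T p (a + x) r"

lemma run_trans: "run T p x q \<Longrightarrow> run T q y r \<Longrightarrow> run T p (x + y) r"
  by (induction rule: run.induct) (auto simp: add.assoc intro: run.intros)

lemma run_mono: "run T p x q \<Longrightarrow> T \<subseteq> T' \<Longrightarrow> run T' p x q"
  by (induction rule: run.induct) (auto intro: run.intros)

text \<open>
  Kleene's elimination step, one transition instead of one state at a time: cut at every use of
  the new transition \<open>s \<rightarrow> t\<close>, a run consists of an old run ending at \<open>s\<close>, of any number of old runs
  from \<open>t\<close> back to \<open>s\<close>, and of an old run starting at \<open>t\<close>. Since labels commute, the middle part
  contributes an element of a monoid.
\<close>

lemma runs_insert: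
  fixes T :: "('q \<times> 'a::comm_monoid_add \<times> 'q) set" and p q s t g
  defines "T' \<equiv> insert (s, g, t) T"
  shows "{x. run T' p x q} = {x. run T p x q} \<union>
    ({x. run T p x s} + {g} + monoid_span ({x. run T t x s} + {g}) + {x. run T t x q})"
    (is "_ = _ \<union> ?R p q")
proof -
  \<comment> \<open>The labels of the loops from \<open>t\<close> to \<open>t\<close> that end with the new transition.\<close>
  define M where "M = monoid_span ({x. run T t x s} + {g})"
  have R_iff: "x \<in> ?R p q \<longleftrightarrow>
      (\<exists>a c b. run T p a s \<and> c \<in> M \<and> run T t b q \<and> x = a + g + c + b)" for x p q
    unfolding M_def[symmetric] by (simp add: set_plus_def) blast
  have M_step: "a + g + c \<in> M" if "run T t a s" "c \<in> M" for a c
    using that unfolding M_def by (auto intro!: monoid_span_step)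
  have "0 \<in> M" by (simp add: M_def monoid_span_zero)
  have "run T p x q \<or> x \<in> ?R p q" if "run T' p x q" for x
    using that
  proof (induction rule: run.induct)
    case (run_Nil q)
    then show ?case by (simp add: run.run_Nil)
  next
    case (run_Cons p a p' x r)
    show ?case
    proof (cases "(p, a, p') \<in> T")
      case True
      then have step: "run T p' y u \<Longrightarrow> run T p (a + y) u" for y u
        by (rule run.run_Cons)
      from run_Cons.IH show ?thesis
      proof
        assume "x \<in> ?R p' r"
        then obtain b c d where x: "run T p' b s" "c \<in> M" "run T t d r" "x = b + g + c + d"
          unfolding R_iff by blast
        then have "a + x = (a + b) + g + c + d" by (simp add: add.assoc)
        then have "a + x \<in> ?R p r" unfolding R_iff using x step[OF x(1)] by blast
        then show ?thesis ..
      qed (simp add: step)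
    next
      case False
      then have eq: "p = s" "a = g" "p' = t" using run_Cons.hyps by (auto simp: T'_def)
      have nil: "run T s 0 s" by (rule run.run_Nil)
      from run_Cons.IH have "a + x \<in> ?R p r"
      proof
        assume "run T p' x r"
        moreover have "a + x = 0 + g + 0 + x" using eq by simp
        ultimately show ?thesis unfolding R_iff eq using \<open>0 \<in> M\<close> nil by blast
      next
        assume "x \<in> ?R p' r"
        then obtain b c d where x: "run T t b s" "c \<in> M" "run T t d r" "x = b + g + c + d"
          unfolding R_iff eq by blast
        have "a + x = 0 + g + (b + g + c) + d" using x(4) eq by (simp add: add.assoc)
        then show ?thesis unfolding R_iff eq using nil M_step[OF x(1,2)] x(3) by blast
      qed
      then show ?thesis ..
    qed
  qed
  moreover have T: "run T p x q \<Longrightarrow> run T' p x q" for p x q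
    by (rule run_mono) (auto simp: T'_def)
  have g: "run T' s g t" using run_Cons[OF _ run_Nil, of s g t T'] by (simp add: T'_def)
  have star: "run T' t c t" if "c \<in> M" for c
    using that unfolding M_def
  proof induction
    case (monoid_span_step y c)
    then obtain a where "y = a + g" "run T t a s" by (auto elim: set_plus_elim)
    then show ?case using run_trans[OF run_trans[OF T g] monoid_span_step.IH] by simp
  qed (rule run_Nil)
  have "run T' p (a + g + c + b) q" if "run T p a s" "c \<in> M" "run T t b q" for a b c
    using run_trans[OF run_trans[OF run_trans[OF T[OF that(1)] g] star[OF that(2)]] T[OF that(3)]] .
  then have "run T' p x q" if "x \<in> ?R p q" for x
    using that unfolding R_iff by blast
  ultimately show ?thesis using T by blast
qed

lemma semilinear_runs:
  assumes "finite T" shows "semilinear {x. run T p x q}"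
  using assms
proof (induction arbitrary: p q rule: finite_induct)
  case empty
  have *: "{x. run {} p x q} = (if p = q then {0} else {})"
    by (auto elim: run.cases intro: run_Nil)
  show ?case unfolding * by (auto intro: semilinear_singleton semilinear_empty)
next
  case (insert e T)
  obtain s g t where "e = (s, g, t)" by (cases e)
  then show ?case
    unfolding \<open>e = (s, g, t)\<close> runs_insert
    by (intro semilinear_Un semilinear_plus semilinear_monoid_span semilinear_singleton insert.IH)
qed

text \<open>
  Removing the first transition of a run lowers the weight bound, because weights are positive; so
  induction on the bound applies.
\<close>

lemma finite_light_runs:
  fixes T :: "('q \<times> (nat \<times> 'a::comm_monoid_add) \<times> 'q) set"
  assumes "finite T" "\<And>p k h q. (p, (k, h), q) \<in> T \<Longrightarrow> k > 0"
  shows "finite {z. fst z \<le> a \<and> (\<exists>p q. run T p z q)}"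
proof (induction a rule: less_induct)
  case (less a)
  let ?S = "\<lambda>a. {z. fst z \<le> a \<and> (\<exists>p q. run T p z q)}"
  let ?U = "\<Union>t\<in>T. if a = 0 then {} else (\<lambda>z. fst (snd t) + z) ` ?S (a - 1)"
  have "?S a \<subseteq> insert 0 ?U"
  proof clarify
    fix k h p q assume r: "fst (k, h) \<le> a" "run T p (k, h) q" "(k, h) \<notin> ?U"
    from r(2) show "(k, h) = 0"
    proof cases
      case (run_Cons b p' z)
      obtain k' h' where b: "b = (k', h')" by (cases b)
      have "k' > 0" using run_Cons(2) assms(2) b by blast
      moreover have "k = k' + fst z" using run_Cons(1) b by (cases z) simp
      ultimately have z: "fst z \<le> a - 1" "a \<noteq> 0" using r(1) by auto
      then have "(k, h) \<in> ?U"
        using run_Cons by (intro UN_I[of "(p, b, p')"]) auto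
      then show ?thesis using r(3) by simp
    qed simp
  qed
  moreover have "finite ?U" using assms(1) less by auto
  ultimately show ?case using finite_subset by blast
qed

section \<open>Rational power series\<close>

lemma finite_splittings: "finite {(a, b). a + b = (c :: 'd::finite \<Rightarrow>\<^sub>0 nat)}"
proof -
  let ?D = "{a. \<exists>b. a + b = c}"
  have "Poly_Mapping.lookup ` ?D \<subseteq> (UNIV \<rightarrow>\<^sub>E (\<Union>i. {..Poly_Mapping.lookup c i}))"
    by (force simp: lookup_add)
  then have "finite (Poly_Mapping.lookup ` ?D)"
    by (rule finite_subset) (intro finite_PiE finite_UN_I, auto)
  then have "finite ?D"
    by (rule finite_imageD) (auto intro!: inj_onI poly_mapping_eqI)
  moreover have "fst ` {(a, b). a + b = c} \<subseteq> ?D" by auto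
  ultimately have "finite (fst ` {(a, b). a + b = c})" by (rule finite_subset[rotated])
  then show ?thesis by (rule finite_imageD) (auto intro!: inj_onI)
qed

lemma lookup_times:
  fixes p q :: "('d::finite \<Rightarrow>\<^sub>0 nat) \<Rightarrow>\<^sub>0 int"
  shows "Poly_Mapping.lookup (p * q) c = poly_times_series p (Poly_Mapping.lookup q) c"
proof -
  have "Poly_Mapping.lookup (p * q) c = prod_fun (Poly_Mapping.lookup p) (Poly_Mapping.lookup q) c"
    by (simp add: lookup_mult prod_fun_def)
  also have "\<dots> = (\<Sum>(a, b). Poly_Mapping.lookup p a * Poly_Mapping.lookup q b when c = a + b)"
    by (rule prod_fun_unfold_prod) simp_all
  also have "\<dots> = (\<Sum>(a, b) | a + b = c. Poly_Mapping.lookup p a * Poly_Mapping.lookup q b when c = a + b)"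
    by (rule Sum_any.expand_superset[OF finite_splittings]) (auto simp: when_def split: if_splits)
  also have "\<dots> = (\<Sum>(a, b) | a + b = c. Poly_Mapping.lookup p a * Poly_Mapping.lookup q b)"
    by (rule sum.cong) auto
  finally show ?thesis by (simp add: poly_times_series_def)
qed

lemma poly_times_series_cong:
  assumes "\<And>a b. a + b = c \<Longrightarrow> F b = G b"
  shows "poly_times_series Q F c = poly_times_series Q G c"
  unfolding poly_times_series_def by (rule sum.cong) (auto simp: assms)

lemma finite_divisors: "finite {b. \<exists>a. a + b = (c :: 'd::finite \<Rightarrow>\<^sub>0 nat)}"
proof -
  have "{b. \<exists>a. a + b = c} = snd ` {(a, b). a + b = c}" by force
  then show ?thesis using finite_splittings[of c] by simp
qed

text \<open>
  The coefficient of \<open>z\<^sup>c\<close> in a product involves only finitely many coefficients, so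
  a series may be replaced by a polynomial there. This transfers identities such as associativity
  from the ring of polynomials.
\<close>

lemma series_eq_poly_upto:
  "\<exists>T. \<forall>a b. a + b = (c :: 'd::finite \<Rightarrow>\<^sub>0 nat) \<longrightarrow> Poly_Mapping.lookup T b = F b"
proof -
  define f where "f b = (if \<exists>a. a + b = c then F b else 0)" for b
  have "finite {b. f b \<noteq> 0}"
    by (rule finite_subset[OF _ finite_divisors[of c]]) (auto simp: f_def)
  then have "Poly_Mapping.lookup (Abs_poly_mapping f) b = F b" if "a + b = c" for a b
    using that by (auto simp: f_def)
  then show ?thesis by blast
qed

lemma poly_times_series_assoc:
  fixes F :: "'d::finite power_series"
  shows "poly_times_series (p * q) F = poly_times_series p (poly_times_series q F)"
proof
  fix c
  obtain T where T: "\<And>a b. a + b = c \<Longrightarrow> Poly_Mapping.lookup T b = F b"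
    using series_eq_poly_upto[of c F] by blast
  have "poly_times_series (p * q) F c = Poly_Mapping.lookup (p * (q * T)) c"
    unfolding mult.assoc[symmetric] lookup_times[of "p * q"]
    by (rule poly_times_series_cong) (simp add: T)
  also have "\<dots> = poly_times_series p (poly_times_series q F) c"
    unfolding lookup_times[of p]
  proof (rule poly_times_series_cong)
    fix a b assume "a + b = c"
    then have "Poly_Mapping.lookup T b' = F b'" if "a' + b' = b" for a' b'
      using that T[of "a + a'" b'] by (simp add: add.assoc)
    then show "Poly_Mapping.lookup (q * T) b = poly_times_series q F b"
      unfolding lookup_times[of q] by (rule poly_times_series_cong)
  qed
  finally show "poly_times_series (p * q) F c = \<dots>" .
qed

lemma poly_times_series_lookup:
  fixes p q :: "('d::finite \<Rightarrow>\<^sub>0 nat) \<Rightarrow>\<^sub>0 int"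
  shows "poly_times_series p (Poly_Mapping.lookup q) = Poly_Mapping.lookup (p * q)"
  by (rule ext) (simp add: lookup_times)

lemma poly_times_series_linear:
  "poly_times_series p (\<lambda>c. F c + m * G c) =
    (\<lambda>c. poly_times_series p F c + m * poly_times_series p G c)"
  unfolding poly_times_series_def sum_distrib_left sum.distrib[symmetric]
  by (intro ext sum.cong) (auto simp: algebra_simps)

lemma poly_times_series_diff_left:
  "poly_times_series (p - q) F = (\<lambda>c. poly_times_series p F c - poly_times_series q F c)"
  unfolding poly_times_series_def sum_subtractf[symmetric]
  by (intro ext sum.cong) (auto simp: algebra_simps lookup_minus)

lemma single_times_series_add:
  fixes k :: "'d::finite \<Rightarrow>\<^sub>0 nat"
  shows "poly_times_series (Poly_Mapping.single k 1) F (k + b) = F b"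
proof -
  have "poly_times_series (Poly_Mapping.single k 1) F (k + b) =
      (\<Sum>x\<in>{(k, b)}. case x of (a, b) \<Rightarrow> Poly_Mapping.lookup (Poly_Mapping.single k 1) a * F b)"
    unfolding poly_times_series_def
    by (rule sum.mono_neutral_right[OF finite_splittings]) (auto simp: lookup_single when_def split: if_splits)
  then show ?thesis by simp
qed

lemma single_times_series_0:
  assumes "\<And>b. c \<noteq> k + b"
  shows "poly_times_series (Poly_Mapping.single k 1) F c = 0"
  unfolding poly_times_series_def
  by (rule sum.neutral) (use assms in \<open>auto simp: lookup_single when_def split: if_splits\<close>)

lemma one_times_series: "poly_times_series 1 F = (F :: 'd::finite power_series)"
  using single_times_series_add[of 0 F] by auto

lemma lookup_times_0:
  fixes p q :: "('d::finite \<Rightarrow>\<^sub>0 nat) \<Rightarrow>\<^sub>0 int"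
  shows "Poly_Mapping.lookup (p * q) 0 = Poly_Mapping.lookup p 0 * Poly_Mapping.lookup q 0"
proof -
  have "a + b = 0 \<longleftrightarrow> a = 0 \<and> b = 0" for a b :: "'d \<Rightarrow>\<^sub>0 nat"
  proof
    assume "a + b = 0"
    then have "Poly_Mapping.lookup a i + Poly_Mapping.lookup b i = 0" for i
      using lookup_add[of a b i] by simp
    then show "a = 0 \<and> b = 0" by (auto intro!: poly_mapping_eqI)
  qed simp
  then have "{(a, b). a + b = (0 :: 'd \<Rightarrow>\<^sub>0 nat)} = {(0, 0)}" by auto
  then show ?thesis by (simp add: lookup_times poly_times_series_def)
qed

text \<open>
  Requiring the constant term 1 makes the admissible denominators closed under products and
  excludes 0, without knowing that polynomials over an arbitrary finite index type form an
  integral domain.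
\<close>

definition unit_rational :: "'d power_series \<Rightarrow> bool" where
  "unit_rational F \<longleftrightarrow> (\<exists>P Q :: ('d \<Rightarrow>\<^sub>0 nat) \<Rightarrow>\<^sub>0 int.
    Poly_Mapping.lookup Q 0 = 1 \<and> poly_times_series Q F = Poly_Mapping.lookup P)"

lemma unit_rational_imp_rational: "unit_rational F \<Longrightarrow> is_rational_series F"
  unfolding unit_rational_def is_rational_series_def by (metis lookup_zero zero_neq_one)

lemma unit_rational_finite:
  fixes F :: "'d::finite power_series"
  assumes "finite {c. F c \<noteq> 0}"
  shows "unit_rational F"
  unfolding unit_rational_def
  by (rule exI[of _ "Abs_poly_mapping F"], rule exI[of _ 1]) (simp add: assms one_times_series)

lemma unit_rational_linear:
  fixes F G :: "'d::finite power_series"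
  assumes "unit_rational F" "unit_rational G"
  shows "unit_rational (\<lambda>c. F c + m * G c)"
proof -
  obtain P Q where F: "Poly_Mapping.lookup Q 0 = 1" "poly_times_series Q F = Poly_Mapping.lookup P"
    using assms(1) by (auto simp: unit_rational_def)
  obtain P' Q' where G: "Poly_Mapping.lookup Q' 0 = 1" "poly_times_series Q' G = Poly_Mapping.lookup P'"
    using assms(2) by (auto simp: unit_rational_def)
  have "poly_times_series (Q' * Q) F = Poly_Mapping.lookup (Q' * P)"
    by (simp add: poly_times_series_assoc F poly_times_series_lookup)
  moreover have "poly_times_series (Q' * Q) G = Poly_Mapping.lookup (Q * P')"
    by (simp add: mult.commute[of Q'] poly_times_series_assoc G poly_times_series_lookup)
  moreover have "Poly_Mapping.lookup (Q' * P + Poly_Mapping.single 0 m * (Q * P')) =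
      (\<lambda>c. Poly_Mapping.lookup (Q' * P) c + m * Poly_Mapping.lookup (Q * P') c)"
    by (auto simp: lookup_add mult_map_scale_conv_mult[symmetric] Poly_Mapping.map.rep_eq when_def)
  ultimately have "poly_times_series (Q' * Q) (\<lambda>c. F c + m * G c) =
      Poly_Mapping.lookup (Q' * P + Poly_Mapping.single 0 m * (Q * P'))"
    by (simp add: poly_times_series_linear)
  moreover have "Poly_Mapping.lookup (Q' * Q) 0 = 1" by (simp add: lookup_times_0 F G)
  ultimately show ?thesis unfolding unit_rational_def by blast
qed

lemma unit_rational_diff:
  fixes F G :: "'d::finite power_series"
  shows "unit_rational F \<Longrightarrow> unit_rational G \<Longrightarrow> unit_rational (\<lambda>c. F c - G c)"
  using unit_rational_linear[of F G "-1"] by simp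

lemma unit_rational_add:
  fixes F G :: "'d::finite power_series"
  shows "unit_rational F \<Longrightarrow> unit_rational G \<Longrightarrow> unit_rational (\<lambda>c. F c + G c)"
  using unit_rational_linear[of F G 1] by simp

lemma unit_rational_times:
  fixes F :: "'d::finite power_series"
  assumes "unit_rational F" shows "unit_rational (poly_times_series R F)"
proof -
  obtain P Q where F: "Poly_Mapping.lookup Q 0 = 1" "poly_times_series Q F = Poly_Mapping.lookup P"
    using assms(1) by (auto simp: unit_rational_def)
  have "poly_times_series Q (poly_times_series R F) = poly_times_series (R * Q) F"
    by (simp add: poly_times_series_assoc[symmetric] mult.commute)
  also have "\<dots> = Poly_Mapping.lookup (R * P)"
    by (simp add: poly_times_series_assoc F poly_times_series_lookup)
  finally show ?thesis using F(1) unfolding unit_rational_def by blast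
qed

lemma unit_rational_divide:
  fixes F :: "'d::finite power_series"
  assumes "unit_rational (poly_times_series R F)" "Poly_Mapping.lookup R 0 = 1"
  shows "unit_rational F"
proof -
  obtain P Q where F: "Poly_Mapping.lookup Q 0 = 1"
    "poly_times_series Q (poly_times_series R F) = Poly_Mapping.lookup P"
    using assms(1) by (auto simp: unit_rational_def)
  then have "poly_times_series (Q * R) F = Poly_Mapping.lookup P"
    by (simp add: poly_times_series_assoc)
  moreover have "Poly_Mapping.lookup (Q * R) 0 = 1"
    using F assms(2) by (simp add: lookup_times_0)
  ultimately show ?thesis unfolding unit_rational_def by blast
qed

section \<open>Counting the points of a semilinear set by degree\<close>

definition finite_fibres :: "('a \<Rightarrow> 'b) \<Rightarrow> 'a set \<Rightarrow> bool" where
  "finite_fibres deg X \<longleftrightarrow> (\<forall>a. finite {x \<in> X. deg x = a})"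

definition counting_series :: "('a \<Rightarrow> ('d \<Rightarrow>\<^sub>0 nat)) \<Rightarrow> 'a set \<Rightarrow> 'd power_series" where
  "counting_series deg X = (\<lambda>a. int (card {x \<in> X. deg x = a}))"

lemma finite_fibres_subset:
  assumes "finite_fibres deg X" "Z \<subseteq> X" shows "finite_fibres deg Z"
  unfolding finite_fibres_def
proof
  fix a
  have "{x \<in> Z. deg x = a} \<subseteq> {x \<in> X. deg x = a}" using assms(2) by blast
  then show "finite {x \<in> Z. deg x = a}"
    using assms(1) finite_subset unfolding finite_fibres_def by metis
qed

lemma counting_series_Un:
  assumes "finite_fibres deg X" "finite_fibres deg Z"
  shows "counting_series deg (X \<union> Z) =
    (\<lambda>a. counting_series deg X a + counting_series deg Z a - counting_series deg (X \<inter> Z) a)"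
proof
  fix a
  let ?X = "{x \<in> X. deg x = a}" and ?Z = "{x \<in> Z. deg x = a}"
  have "card ?X + card ?Z = card (?X \<union> ?Z) + card (?X \<inter> ?Z)"
    using assms by (intro card_Un_Int) (auto simp: finite_fibres_def)
  moreover have "?X \<union> ?Z = {x \<in> X \<union> Z. deg x = a}" "?X \<inter> ?Z = {x \<in> X \<inter> Z. deg x = a}"
    by auto
  ultimately show "counting_series deg (X \<union> Z) a =
      counting_series deg X a + counting_series deg Z a - counting_series deg (X \<inter> Z) a"
    by (simp add: counting_series_def)
qed

lemma counting_series_shift:
  fixes deg :: "'a::cancel_comm_monoid_add \<Rightarrow> ('d::finite \<Rightarrow>\<^sub>0 nat)"
  assumes deg: "\<And>x y. deg (x + y) = deg x + deg y"
  shows "counting_series deg ((\<lambda>x. p + x) ` X) =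
    poly_times_series (Poly_Mapping.single (deg p) 1) (counting_series deg X)"
proof
  fix c
  show "counting_series deg ((\<lambda>x. p + x) ` X) c =
    poly_times_series (Poly_Mapping.single (deg p) 1) (counting_series deg X) c"
  proof (cases "\<exists>b. c = deg p + b")
    case True
    then obtain b where b: "c = deg p + b" ..
    have "{x \<in> (\<lambda>x. p + x) ` X. deg x = c} = (\<lambda>x. p + x) ` {x \<in> X. deg x = b}"
      by (auto simp: deg b)
    then show ?thesis
      by (simp add: b single_times_series_add counting_series_def card_image)
  next
    case False
    then have *: "{x \<in> (\<lambda>x. p + x) ` X. deg x = c} = {}" by (auto simp: deg)
    have "poly_times_series (Poly_Mapping.single (deg p) 1) (counting_series deg X) c = 0"
      by (rule single_times_series_0) (use False in blast)
    then show ?thesis unfolding counting_series_def * by simp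
  qed
qed

lemma finite_monoid_span_torsion:
  assumes "nat_scale n p = 0" "n > 0"
  shows "finite (monoid_span {p})"
proof -
  have "x \<in> (\<lambda>j. nat_scale j p) ` {..<n}" if "x \<in> monoid_span {p}" for x
    using that
  proof induction
    case monoid_span_zero
    show ?case using assms by (intro image_eqI[of _ _ 0]) auto
  next
    case (monoid_span_step q x)
    then obtain j where j: "x = nat_scale j p" "j < n" by auto
    have "q + x = nat_scale (if Suc j = n then 0 else Suc j) p"
      using monoid_span_step j assms by (cases "Suc j = n") auto
    then show ?case by (rule image_eqI) (use j assms in auto)
  qed
  then show ?thesis by (meson finite_imageI finite_lessThan finite_subset subsetI)
qed

text \<open>
  Applied to a generator of degree 0: all the translates of a point by its multiples lie in one
  fibre, and if that is finite then two of them coincide.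
\<close>

lemma torsion_of_finite_fibre:
  fixes f p :: "'a::cancel_comm_monoid_add"
  assumes "finite ((\<lambda>j. f + nat_scale j p) ` UNIV)"
  obtains n where "n > 0" "nat_scale n p = 0"
proof -
  have "\<not> inj (\<lambda>j. f + nat_scale j p)"
    using assms finite_imageD infinite_UNIV_nat by blast
  then obtain i j where "i < j" "f + nat_scale i p = f + nat_scale j p"
    unfolding inj_def by (metis linorder_less_linear)
  moreover have "nat_scale j p = nat_scale i p + nat_scale (j - i) p"
    using \<open>i < j\<close> by (simp flip: nat_scale_add)
  ultimately show thesis using that[of "j - i"] by simp
qed

text \<open>
  Hilbert and Serre's induction on the number of generators: a new generator \<open>p\<close> turns
  \<open>A = F + \<langle>P\<rangle>\<close> into a set \<open>X\<close> with \<open>X = A \<union> (p + X)\<close>. It needs \<open>deg p \<noteq> 0\<close>, so that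
  \<open>1 - z\<^bsup>deg p\<^esup>\<close> is a denominator with constant term 1. If \<open>deg p = 0\<close> and \<open>X\<close> is not empty, then the
  finite fibres force \<open>p\<close> to generate a finite monoid, which is absorbed into \<open>F\<close>.
\<close>

lemma counting_series_fg_rational:
  fixes deg :: "'a::cancel_comm_monoid_add \<Rightarrow> ('d::finite \<Rightarrow>\<^sub>0 nat)"
  assumes deg: "\<And>x y. deg (x + y) = deg x + deg y"
    and "finite P" "finite F" "finite_fibres deg (F + monoid_span P)"
  shows "unit_rational (counting_series deg (F + monoid_span P))"
  using assms(2-)
proof (induction P arbitrary: F rule: finite_induct)
  case empty
  have "{c. counting_series deg F c \<noteq> 0} \<subseteq> deg ` F"
    by (auto simp: counting_series_def card_gt_0_iff)
  then show ?case
    using empty finite_subset by (auto simp flip: set_zero intro!: unit_rational_finite)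
next
  case (insert p P)
  define X where "X = F + monoid_span (insert p P)"
  have X: "X = (F + monoid_span {p}) + monoid_span P"
    using monoid_span_Un[of "{p}" P] by (simp add: X_def add.assoc)
  show ?case
  proof (cases "deg p = 0")
    case True
    show ?thesis
    proof (cases "F = {}")
      case True
      then show ?thesis by (simp add: counting_series_def unit_rational_finite)
    next
      case False
      then obtain f where f: "f \<in> F" by auto
      have d: "deg (f + nat_scale j p) = deg f" for j
      proof (induction j)
        case (Suc j)
        have "f + nat_scale (Suc j) p = p + (f + nat_scale j p)" by (simp add: ac_simps)
        then show ?case using Suc deg[of p "f + nat_scale j p"] True by simp
      qed simp
      \<comment> \<open>The whole orbit of \<open>f\<close> under \<open>p\<close> lies in one finite fibre, so \<open>p\<close> has finite order.\<close>
      have "f + nat_scale j p \<in> X" for j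
        unfolding X_def using f by (intro set_plus_intro nat_scale_in_monoid_span monoid_span_base) auto
      then have "range (\<lambda>j. f + nat_scale j p) \<subseteq> {x \<in> X. deg x = deg f}" using d by auto
      then have "finite (range (\<lambda>j. f + nat_scale j p))"
        using insert.prems(2) unfolding X_def finite_fibres_def by (meson finite_subset)
      then obtain n where "n > 0" "nat_scale n p = 0" by (rule torsion_of_finite_fibre)
      then have "finite (monoid_span {p})" by (intro finite_monoid_span_torsion)
      then have "unit_rational (counting_series deg ((F + monoid_span {p}) + monoid_span P))"
        using insert.prems X by (intro insert.IH finite_set_plus) (simp_all add: X_def)
      then show ?thesis using X by (simp add: X_def)
    qed
  next
    case False
    \<comment> \<open>\<open>A\<close> collects the points that can be reached without \<open>p\<close>, \<open>B\<close> those reached using \<open>p\<close> at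
       least once.\<close>
    define A where "A = F + monoid_span P"
    define B where "B = (\<lambda>x. p + x) ` X"
    have "monoid_span {p} = {0} \<union> (\<lambda>x. p + x) ` monoid_span {p}"
    proof
      show "monoid_span {p} \<subseteq> {0} \<union> (\<lambda>x. p + x) ` monoid_span {p}"
        by (auto elim: monoid_span.cases)
    qed (auto intro: monoid_span.intros)
    then have "X = F + ({0} \<union> (\<lambda>x. p + x) ` monoid_span {p}) + monoid_span P"
      using X by simp
    also have "F + ({0} \<union> (\<lambda>x. p + x) ` monoid_span {p}) + monoid_span P =
        (F + {0} + monoid_span P) \<union> (F + ({p} + monoid_span {p}) + monoid_span P)"
      by (simp only: set_plus_Un_distrib singleton_plus)
    also have "F + {0} + monoid_span P = A" by (simp add: A_def flip: set_zero)
    also have "F + ({p} + monoid_span {p}) + monoid_span P = B"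
      unfolding B_def X singleton_plus[symmetric] by (simp only: ac_simps)
    finally have Un: "X = A \<union> B" .
    have fin: "finite_fibres deg A" "finite_fibres deg B"
      using insert.prems(2) finite_fibres_subset Un unfolding X_def by blast+
    \<comment> \<open>Only \<open>P\<close>, not \<open>p\<close>, acts on the overlap; the Noetherian property makes it finitely generated
       over \<open>P\<close>, so that the induction hypothesis applies to it.\<close>
    obtain F' where F': "finite F'" "A \<inter> B = F' + monoid_span P"
    proof (rule submodule_fg[OF insert.prems(1) insert.hyps(1), of "A \<inter> B"])
      show "A \<inter> B \<subseteq> F + monoid_span P" by (simp add: A_def)
      show "x + m \<in> A \<inter> B" if xm: "x \<in> A \<inter> B" "m \<in> monoid_span P" for x m
      proof
        have *: "y + m \<in> G + monoid_span P" if "y \<in> G + monoid_span P" for y G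
        proof -
          obtain g k where "y = g + k" "g \<in> G" "k \<in> monoid_span P"
            using \<open>y \<in> G + monoid_span P\<close> by (rule set_plus_elim)
          then show ?thesis
            using set_plus_intro[of g G "k + m" "monoid_span P"] xm(2)
            by (simp add: add.assoc monoid_span_add)
        qed
        show "x + m \<in> A" using xm * by (simp add: A_def)
        show "x + m \<in> B" using xm *[of _ "F + monoid_span {p}"]
          by (auto simp: B_def X add.assoc)
      qed
    qed
    have "unit_rational (counting_series deg A)"
      unfolding A_def using insert.prems(1) fin(1) by (intro insert.IH) (simp_all add: A_def)
    moreover have "unit_rational (counting_series deg (A \<inter> B))"
      using insert.IH[OF F'(1)] finite_fibres_subset[OF fin(1) Int_lower1, of B]
      unfolding F'(2) by blast
    ultimately have "unit_rational (\<lambda>c. counting_series deg A c - counting_series deg (A \<inter> B) c)"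
      by (rule unit_rational_diff)
    also have "(\<lambda>c. counting_series deg A c - counting_series deg (A \<inter> B) c) =
        (\<lambda>c. counting_series deg X c - counting_series deg B c)"
      unfolding Un counting_series_Un[OF fin] by auto
    also have "\<dots> = poly_times_series (1 - Poly_Mapping.single (deg p) 1) (counting_series deg X)"
      unfolding B_def counting_series_shift[OF deg] poly_times_series_diff_left one_times_series ..
    finally have "unit_rational (counting_series deg X)"
      by (rule unit_rational_divide) (use False in \<open>simp add: lookup_minus lookup_single\<close>)
    then show ?thesis by (simp add: X_def)
  qed
qed

lemma counting_series_fg_subset_rational:
  fixes deg :: "'a::cancel_comm_monoid_add \<Rightarrow> ('d::finite \<Rightarrow>\<^sub>0 nat)"
  assumes deg: "\<And>x y. deg (x + y) = deg x + deg y"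
    and "fg_subset X" "finite_fibres deg X"
  shows "unit_rational (counting_series deg X)"
  using counting_series_fg_rational[OF deg] assms by (auto simp: fg_subset_def)

text \<open>
  Inclusion-exclusion over the pieces of a semilinear set. The induction carries along the
  intersections with an arbitrary finitely generated module, since the overlap of a new piece
  with the old ones is of this form.
\<close>

lemma counting_series_semilinear_rational:
  fixes deg :: "'a::cancel_comm_monoid_add \<Rightarrow> ('d::finite \<Rightarrow>\<^sub>0 nat)"
  assumes deg: "\<And>x y. deg (x + y) = deg x + deg y"
    and "semilinear X" "finite_fibres deg X"
  shows "unit_rational (counting_series deg X)"
proof -
  have "unit_rational (counting_series deg X) \<and>
    (\<forall>V. fg_subset V \<longrightarrow> unit_rational (counting_series deg (V \<inter> X)))"
    using assms(2,3)
  proof (induction rule: semilinear.induct)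
    case semilinear_empty
    then show ?case by (simp add: counting_series_def unit_rational_finite)
  next
    case (semilinear_insert P X f)
    let ?L = "{f} + monoid_span P"
    have L: "fg_subset ?L" using semilinear_insert by (auto simp: fg_subset_def)
    have fin: "finite_fibres deg Z" if "Z \<subseteq> ?L \<union> X" for Z
      using that semilinear_insert.prems finite_fibres_subset by blast
    have IH: "unit_rational (counting_series deg X)"
      "fg_subset V \<Longrightarrow> unit_rational (counting_series deg (V \<inter> X))" for V
      using semilinear_insert.IH fin[of X] by auto
    have rat: "unit_rational (counting_series deg Z)" if "fg_subset Z" "Z \<subseteq> ?L" for Z
      using counting_series_fg_subset_rational[OF deg] that fin[of Z] by blast
    have "unit_rational (counting_series deg (?L \<union> X))"
      unfolding counting_series_Un[OF fin[OF Un_upper1] fin[OF Un_upper2]]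
      by (intro unit_rational_diff unit_rational_add IH rat L) simp
    moreover have "unit_rational (counting_series deg (V \<inter> (?L \<union> X)))" if V: "fg_subset V" for V
    proof -
      have VL: "fg_subset (V \<inter> ?L)" using V L by (rule fg_subset_Int)
      have eq: "V \<inter> (?L \<union> X) = (V \<inter> ?L) \<union> (V \<inter> X)" "(V \<inter> ?L) \<inter> (V \<inter> X) = (V \<inter> ?L) \<inter> X"
        by auto
      have fin_V: "finite_fibres deg (V \<inter> ?L)" "finite_fibres deg (V \<inter> X)"
        by (rule fin; blast)+
      show ?thesis
        unfolding eq(1) counting_series_Un[OF fin_V] eq(2)
        by (rule unit_rational_diff[OF unit_rational_add[OF rat[OF VL Int_lower2] IH(2)[OF V]]
              IH(2)[OF VL]])
    qed
    ultimately show ?case by blast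
  qed
  then show ?thesis ..
qed

section \<open>From balls to spheres\<close>

text \<open>
  The conditions \<open>d \<le> a\<^sub>i\<close> are turned into \<open>d = a\<^sub>i\<close> one coordinate \<open>j\<close> at a time, which multiplies the
  series by \<open>1 - z\<^sub>j\<close>: a point with \<open>d \<le> a\<^sub>j\<close> has either \<open>d = a\<^sub>j\<close> or \<open>d \<le> a\<^sub>j - 1\<close>.
\<close>

lemma sphere_rational_of_ball_rational:
  fixes d :: "'v \<Rightarrow> enat" and Y :: "('d::finite \<Rightarrow> 'v) set"
  assumes fin: "\<And>a. finite {y \<in> Y. \<forall>i. d (y i) \<le> enat (Poly_Mapping.lookup a i)}"
    and ball: "unit_rational (\<lambda>a. int (card {y \<in> Y. \<forall>i. d (y i) \<le> enat (Poly_Mapping.lookup a i)}))"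
  shows "unit_rational (\<lambda>a. int (card {y \<in> Y. \<forall>i. d (y i) = enat (Poly_Mapping.lookup a i)}))"
proof -
  define M where "M J a = {y \<in> Y. \<forall>i. if i \<in> J then d (y i) = enat (Poly_Mapping.lookup a i)
      else d (y i) \<le> enat (Poly_Mapping.lookup a i)}" for J a
  have fin_M: "finite (M J a)" for J a
    by (rule finite_subset[OF _ fin[of a]]) (force simp: M_def split: if_splits)
  have "unit_rational (\<lambda>a. int (card (M J a)))" for J
    using finite[of J]
  proof induction
    case empty
    then show ?case using ball by (simp add: M_def)
  next
    case (insert j J)
    let ?e = "Poly_Mapping.single j (1::nat)"
    define rest where "rest y a \<longleftrightarrow> (\<forall>i. i \<noteq> j \<longrightarrow>
      (if i \<in> J then d (y i) = enat (Poly_Mapping.lookup a i)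
       else d (y i) \<le> enat (Poly_Mapping.lookup a i)))" for y a
    have M_iff: "y \<in> M J a \<longleftrightarrow> y \<in> Y \<and> d (y j) \<le> enat (Poly_Mapping.lookup a j) \<and> rest y a" for y a
      using insert.hyps by (auto simp: M_def rest_def)
    have M_insert_iff: "y \<in> M (insert j J) a \<longleftrightarrow>
        y \<in> Y \<and> d (y j) = enat (Poly_Mapping.lookup a j) \<and> rest y a" for y a
      by (auto simp: M_def rest_def)
    have "(\<lambda>a. int (card (M (insert j J) a))) =
        poly_times_series (1 - Poly_Mapping.single ?e 1) (\<lambda>a. int (card (M J a)))"
    proof
      fix c
      show "int (card (M (insert j J) c)) =
          poly_times_series (1 - Poly_Mapping.single ?e 1) (\<lambda>a. int (card (M J a))) c"
      proof (cases "Poly_Mapping.lookup c j = 0")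
        case True
        have "c \<noteq> ?e + b" for b
          using True by (auto simp: lookup_add)
        then have "poly_times_series (Poly_Mapping.single ?e 1) (\<lambda>a. int (card (M J a))) c = 0"
          by (rule single_times_series_0)
        moreover have "d v = enat 0 \<longleftrightarrow> d v \<le> enat 0" for v
          by (simp add: zero_enat_def[symmetric])
        then have "M (insert j J) c = M J c"
          using True by (auto simp: M_iff M_insert_iff)
        ultimately show ?thesis
          by (simp add: poly_times_series_diff_left one_times_series)
      next
        case False
        define b where "b = c - ?e"
        have c: "c = ?e + b"
        proof (rule poly_mapping_eqI)
          show "Poly_Mapping.lookup c i = Poly_Mapping.lookup (?e + b) i" for i
            using False by (auto simp: b_def lookup_add lookup_minus lookup_single when_def)
        qed
        have b: "Poly_Mapping.lookup c i = (if i = j then Suc (Poly_Mapping.lookup b i)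
            else Poly_Mapping.lookup b i)" for i
          unfolding c by (simp add: lookup_add lookup_single when_def)
        have le_Suc: "d v \<le> enat (Suc k) \<longleftrightarrow> d v = enat (Suc k) \<or> d v \<le> enat k" for v k
          by (cases "d v") auto
        have "M J c = M (insert j J) c \<union> M J b"
        proof (intro Set.set_eqI)
          fix y
          have "rest y c \<longleftrightarrow> rest y b" by (simp add: rest_def b)
          then show "y \<in> M J c \<longleftrightarrow> y \<in> M (insert j J) c \<union> M J b"
            using le_Suc[of "y j" "Poly_Mapping.lookup b j"] b[of j]
            by (auto simp: M_iff M_insert_iff)
        qed
        moreover have "M (insert j J) c \<inter> M J b = {}"
          using b[of j] by (auto simp: M_iff M_insert_iff)
        ultimately have "card (M J c) = card (M (insert j J) c) + card (M J b)"
          by (simp add: card_Un_disjoint fin_M)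
        moreover have "poly_times_series (Poly_Mapping.single ?e 1) (\<lambda>a. int (card (M J a))) c =
            int (card (M J b))"
          unfolding c by (rule single_times_series_add)
        ultimately show ?thesis
          by (simp add: poly_times_series_diff_left one_times_series)
      qed
    qed
    then show ?case using unit_rational_times[OF insert.IH] by simp
  qed
  from this[of UNIV] show ?thesis by (simp add: M_def)
qed

section \<open>Equivariant coordinates on a periodic graph\<close>

lemma (in wf_digraph) weighted_dist_le_iff:
  "weighted_dist G w x y \<le> enat a \<longleftrightarrow> (\<exists>p. awalk x p y \<and> (\<Sum>e\<leftarrow>p. w e) \<le> a)"
proof
  assume "weighted_dist G w x y \<le> enat a"
  then have "weighted_dist G w x y < enat (Suc a)"
    by (metis enat_ord_simps(2) lessI order_le_less_trans)
  then show "\<exists>p. awalk x p y \<and> (\<Sum>e\<leftarrow>p. w e) \<le> a"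
    unfolding weighted_dist_def INF_less_iff by auto
next
  assume "\<exists>p. awalk x p y \<and> (\<Sum>e\<leftarrow>p. w e) \<le> a"
  then show "weighted_dist G w x y \<le> enat a"
    unfolding weighted_dist_def by (auto intro: INF_lower2)
qed

context periodic_graph
begin

abbreviation orb :: "'v \<Rightarrow> 'v set" where
  "orb \<equiv> orbit L actV"

lemma actV_closed: "u \<in> carrier L \<Longrightarrow> x \<in> verts \<Gamma> \<Longrightarrow> actV u x \<in> verts \<Gamma>"
  using V.element_image by blast

lemma actE_closed: "u \<in> carrier L \<Longrightarrow> e \<in> arcs \<Gamma> \<Longrightarrow> actE u e \<in> arcs \<Gamma>"
  using E.element_image by blast

lemma orb_refl: "x \<in> verts \<Gamma> \<Longrightarrow> x \<in> orb x"
  by (rule V.orbit_refl)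

lemma orb_act:
  assumes "u \<in> carrier L" "x \<in> verts \<Gamma>"
  shows "orb (actV u x) = orb x"
proof -
  have sub: "orb (actV v y) \<subseteq> orb y" if vy: "v \<in> carrier L" "y \<in> verts \<Gamma>" for v y
  proof
    fix z assume "z \<in> orb (actV v y)"
    then obtain g where g: "g \<in> carrier L" "z = actV g (actV v y)" by (auto simp: orbit_def)
    then have "z = actV (g \<otimes>\<^bsub>L\<^esub> v) y" using V.composition_rule[OF vy(2) g(1) vy(1)] by simp
    then show "z \<in> orb y" using g vy by (auto simp: orbit_def)
  qed
  have "actV (inv\<^bsub>L\<^esub> u) (actV u x) = x"
    using V.orbit_sym_aux[OF assms refl] .
  then have "orb x \<subseteq> orb (actV u x)"
    using sub[of "inv\<^bsub>L\<^esub> u" "actV u x"] assms actV_closed by simp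
  then show ?thesis using sub[OF assms] by blast
qed

lemma orb_eqD:
  assumes "x \<in> verts \<Gamma>" "orb x = orb y"
  obtains u where "u \<in> carrier L" "x = actV u y"
  using orb_refl[OF assms(1)] assms(2) by (auto simp: orbit_def)

lemma act_free:
  assumes "u \<in> carrier L" "v \<in> carrier L" "x \<in> verts \<Gamma>" "actV u x = actV v x"
  shows "u = v"
proof -
  have "actV (inv\<^bsub>L\<^esub> v \<otimes>\<^bsub>L\<^esub> u) x = actV (inv\<^bsub>L\<^esub> v) (actV v x)"
    using V.composition_rule[OF assms(3), of "inv\<^bsub>L\<^esub> v" u] assms by simp
  also have "\<dots> = x" using V.orbit_sym_aux[OF assms(2,3) refl] .
  finally have "inv\<^bsub>L\<^esub> v \<otimes>\<^bsub>L\<^esub> u \<in> stabilizer L actV x"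
    using assms by (simp add: stabilizer_def)
  then have "inv\<^bsub>L\<^esub> v \<otimes>\<^bsub>L\<^esub> u = \<one>\<^bsub>L\<^esub>" using free_verts[OF assms(3)] by simp
  then show ?thesis using assms by (metis inv_closed inv_equality inv_inv)
qed

lemma lattice_coordinates:
  obtains \<iota> :: "'l \<Rightarrow> nat \<Rightarrow> int" where
    "\<And>u v. u \<in> carrier L \<Longrightarrow> v \<in> carrier L \<Longrightarrow> \<iota> (u \<otimes>\<^bsub>L\<^esub> v) = \<iota> u + \<iota> v"
    "inj_on \<iota> (carrier L)" "\<And>u. \<iota> u n = 0"
proof -
  obtain \<phi> where \<phi>: "\<phi> \<in> iso L (product_group {..<n} (\<lambda>_. integer_group))"
    using rank by (auto simp: is_iso_def)
  define \<iota> where "\<iota> u k = (if k < n then \<phi> u k else 0)" for u k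
  have hom: "\<phi> (u \<otimes>\<^bsub>L\<^esub> v) = (\<lambda>k\<in>{..<n}. \<phi> u k + \<phi> v k)"
    if "u \<in> carrier L" "v \<in> carrier L" for u v
    using \<phi> that by (simp add: iso_def hom_def)
  have ext: "\<phi> u \<in> extensional {..<n}" if "u \<in> carrier L" for u
    using \<phi> that by (auto simp: iso_def hom_def PiE_def)
  have "\<iota> (u \<otimes>\<^bsub>L\<^esub> v) = \<iota> u + \<iota> v" if "u \<in> carrier L" "v \<in> carrier L" for u v
    using hom[OF that] by (auto simp: \<iota>_def)
  moreover have "inj_on \<iota> (carrier L)"
  proof (rule inj_onI)
    fix u v assume uv: "u \<in> carrier L" "v \<in> carrier L" "\<iota> u = \<iota> v"
    have "\<phi> u = \<phi> v"
    proof (rule extensionalityI[OF ext ext])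
      show "\<phi> u k = \<phi> v k" if "k \<in> {..<n}" for k
        using fun_cong[OF uv(3), of k] that by (simp add: \<iota>_def)
    qed (use uv in auto)
    then show "u = v"
      using \<phi> uv by (auto simp: iso_iff dest: inj_onD)
  qed
  moreover have "\<iota> u n = 0" for u by (simp add: \<iota>_def)
  ultimately show thesis by (rule that)
qed

text \<open>
  With a representative chosen in each orbit, a vertex is determined by the unique lattice
  element that moves the representative to it and by the number of its orbit. The lattice element
  fills the coordinates below \<open>n\<close>, the number of the orbit is stored in coordinate \<open>n\<close>.
\<close>

lemma equivariant_embedding:
  obtains \<iota> :: "'l \<Rightarrow> nat \<Rightarrow> int" and pos :: "'v \<Rightarrow> nat \<Rightarrow> int" where
    "\<And>u v. u \<in> carrier L \<Longrightarrow> v \<in> carrier L \<Longrightarrow> \<iota> (u \<otimes>\<^bsub>L\<^esub> v) = \<iota> u + \<iota> v"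
    "inj_on pos (verts \<Gamma>)"
    "\<And>u x. u \<in> carrier L \<Longrightarrow> x \<in> verts \<Gamma> \<Longrightarrow> pos (actV u x) = \<iota> u + pos x"
proof -
  obtain \<iota> :: "'l \<Rightarrow> nat \<Rightarrow> int" where
    hom: "\<And>u v. u \<in> carrier L \<Longrightarrow> v \<in> carrier L \<Longrightarrow> \<iota> (u \<otimes>\<^bsub>L\<^esub> v) = \<iota> u + \<iota> v"
    and inj: "inj_on \<iota> (carrier L)" and \<iota>_n: "\<And>u. \<iota> u n = 0"
    using lattice_coordinates by blast
  obtain idx :: "'v set \<Rightarrow> nat" where idx: "inj_on idx (orbits L (verts \<Gamma>) actV)"
    using finite_imp_inj_to_nat_seg[OF finite_vert_orbits] by blast
  define r where "r x = (SOME y. y \<in> orb x)" for x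
  define g where "g x = (SOME u. u \<in> carrier L \<and> actV u (r x) = x)" for x
  define pos where "pos x = \<iota> (g x) + (\<lambda>k. if k = n then int (idx (orb x)) else 0)" for x
  have r: "r x \<in> verts \<Gamma> \<and> orb (r x) = orb x" if "x \<in> verts \<Gamma>" for x
  proof -
    have "r x \<in> orb x" unfolding r_def using orb_refl[OF that] by (rule someI)
    then obtain u where "u \<in> carrier L" "r x = actV u x" unfolding orbit_def by blast
    then show ?thesis using orb_act actV_closed that by simp
  qed
  have g: "g x \<in> carrier L \<and> actV (g x) (r x) = x" if "x \<in> verts \<Gamma>" for x
  proof -
    have "orb x = orb (r x)" using r that by simp
    then obtain u where "u \<in> carrier L" "x = actV u (r x)" by (rule orb_eqD[OF \<open>x \<in> verts \<Gamma>\<close>])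
    then have "u \<in> carrier L \<and> actV u (r x) = x" by simp
    then show ?thesis unfolding g_def by (rule someI)
  qed
  have "pos (actV u x) = \<iota> u + pos x" if u: "u \<in> carrier L" and x: "x \<in> verts \<Gamma>" for u x
  proof -
    let ?y = "actV u x"
    have y: "?y \<in> verts \<Gamma>" "orb ?y = orb x" using u x actV_closed orb_act by auto
    then have ry: "r ?y = r x" by (simp add: r_def)
    \<comment> \<open>The lattice elements \<open>g (u x)\<close> and \<open>u + g x\<close> (in additive notation) move the representative
       to the same vertex, so freeness identifies them.\<close>
    have "actV (g ?y) (r x) = actV u (actV (g x) (r x))"
      using g[OF y(1)] g[OF x] ry by simp
    also have "\<dots> = actV (u \<otimes>\<^bsub>L\<^esub> g x) (r x)"
      using V.composition_rule r[OF x] g[OF x] u by simp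
    finally have "g ?y = u \<otimes>\<^bsub>L\<^esub> g x"
      using r[OF x] g[OF x] g[OF y(1)] u by (intro act_free) auto
    then show ?thesis
      using hom[OF u] g[OF x] unfolding pos_def y(2) by (simp add: add.assoc)
  qed
  moreover have "inj_on pos (verts \<Gamma>)"
  proof (rule inj_onI)
    fix x y assume xy: "x \<in> verts \<Gamma>" "y \<in> verts \<Gamma>" "pos x = pos y"
    have "idx (orb x) = idx (orb y)"
      using fun_cong[OF xy(3), of n] by (simp add: pos_def \<iota>_n)
    moreover have "orb x \<in> orbits L (verts \<Gamma>) actV" "orb y \<in> orbits L (verts \<Gamma>) actV"
      using xy by (auto simp: orbits_def)
    ultimately have o: "orb x = orb y" using idx by (auto dest: inj_onD)
    have "\<iota> (g x) = \<iota> (g y)" using xy(3) unfolding pos_def o by simp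
    then have "g x = g y" using g xy inj by (auto dest: inj_onD)
    moreover have "r x = r y" using o by (simp add: r_def)
    ultimately show "x = y" using g xy by metis
  qed
  ultimately show thesis using that hom by blast
qed

end

section \<open>Walks as runs of the quotient graph\<close>

text \<open>
  Injective coordinates turn the action of \<open>L\<close> into translations. What follows does not depend on how
  they were chosen, nor on the group in which they take values.
\<close>

locale embedded_periodic_graph = periodic_graph n \<Gamma> w L actV actE
  for n :: nat
    and \<Gamma> :: "('v, 'e) pre_digraph"
    and w :: "'e \<Rightarrow> nat"
    and L :: "('l, 'm) monoid_scheme"
    and actV :: "'l \<Rightarrow> 'v \<Rightarrow> 'v"
    and actE :: "'l \<Rightarrow> 'e \<Rightarrow> 'e" +
  fixes \<iota> :: "'l \<Rightarrow> 'h::ab_group_add" and pos :: "'v \<Rightarrow> 'h"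
  assumes \<iota>_mult: "\<And>u v. u \<in> carrier L \<Longrightarrow> v \<in> carrier L \<Longrightarrow> \<iota> (u \<otimes>\<^bsub>L\<^esub> v) = \<iota> u + \<iota> v"
    and pos_inj: "inj_on pos (verts \<Gamma>)"
    and pos_act: "\<And>u x. u \<in> carrier L \<Longrightarrow> x \<in> verts \<Gamma> \<Longrightarrow> pos (actV u x) = \<iota> u + pos x"
begin

text \<open>
  The arc of the quotient graph below \<open>e\<close>, as a transition labelled with weight and displacement.
\<close>

definition transition :: "'e \<Rightarrow> 'v set \<times> (nat \<times> 'h) \<times> 'v set" where
  "transition e = (orb (tail \<Gamma> e), (w e, pos (head \<Gamma> e) - pos (tail \<Gamma> e)), orb (head \<Gamma> e))"

lemma transition_act:
  assumes "u \<in> carrier L" "e \<in> arcs \<Gamma>"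
  shows "transition (actE u e) = transition e"
  using assms by (simp add: transition_def tail_act head_act weight_act orb_act pos_act)

lemma finite_transitions: "finite (transition ` arcs \<Gamma>)"
proof (rule finite_subset)
  show "transition ` arcs \<Gamma> \<subseteq> (\<lambda>Z. transition (SOME e. e \<in> Z)) ` orbits L (arcs \<Gamma>) actE"
  proof (rule image_subsetI)
    fix e assume e: "e \<in> arcs \<Gamma>"
    let ?e = "SOME e'. e' \<in> orbit L actE e"
    have "?e \<in> orbit L actE e" using E.orbit_refl[OF e] by (rule someI)
    then have "transition ?e = transition e"
      using transition_act e by (auto simp: orbit_def)
    then show "transition e \<in> (\<lambda>Z. transition (SOME e. e \<in> Z)) ` orbits L (arcs \<Gamma>) actE"
      using e by (auto simp: orbits_def intro!: image_eqI[of _ _ "orbit L actE e"])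
  qed
qed (use finite_arc_orbits in simp)

lemma run_of_awalk:
  "awalk x p y \<Longrightarrow>
    run (transition ` arcs \<Gamma>) (orb x) ((\<Sum>e\<leftarrow>p. w e), pos y - pos x) (orb y)"
proof (induction p arbitrary: x)
  case Nil
  then show ?case by (simp add: awalk_Nil_iff run_Nil flip: zero_prod_def)
next
  case (Cons e p)
  then have e: "e \<in> arcs \<Gamma>" "x = tail \<Gamma> e" "awalk (head \<Gamma> e) p y"
    by (auto simp: awalk_Cons_iff)
  have "(orb x, (w e, pos (head \<Gamma> e) - pos x), orb (head \<Gamma> e)) \<in> transition ` arcs \<Gamma>"
    using e by (auto simp: transition_def)
  from run_Cons[OF this Cons.IH[OF e(3)]] show ?case by simp
qed

text \<open>
  Runs lift to walks from any chosen starting vertex above their first state: each transition comes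
  from some arc, and a translate of this arc starts at the current vertex.
\<close>

lemma awalk_of_run:
  assumes "run (transition ` arcs \<Gamma>) q z q'" "x \<in> verts \<Gamma>" "orb x = q"
  shows "\<exists>p y. awalk x p y \<and> z = ((\<Sum>e\<leftarrow>p. w e), pos y - pos x)"
  using assms
proof (induction arbitrary: x rule: run.induct)
  case (run_Nil q)
  then show ?case
    by (intro exI[of _ "[]"] exI[of _ x]) (simp add: awalk_Nil_iff zero_prod_def)
next
  case (run_Cons q a q1 z q')
  then obtain e where e: "e \<in> arcs \<Gamma>" "transition e = (q, a, q1)" by force
  then have "orb x = orb (tail \<Gamma> e)" using run_Cons.prems by (simp add: transition_def)
  then obtain u where u: "u \<in> carrier L" "x = actV u (tail \<Gamma> e)"
    by (rule orb_eqD[OF run_Cons.prems(1)])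
  let ?e = "actE u e"
  have e': "?e \<in> arcs \<Gamma>" "transition ?e = (q, a, q1)" "tail \<Gamma> ?e = x"
    using e u by (simp_all add: actE_closed transition_act tail_act)
  have "orb (head \<Gamma> ?e) = q1" using e' by (simp add: transition_def)
  then obtain p y where p: "awalk (head \<Gamma> ?e) p y"
    "z = ((\<Sum>e\<leftarrow>p. w e), pos y - pos (head \<Gamma> ?e))"
    using run_Cons.IH head_in_verts[OF e'(1)] by blast
  have "awalk x (?e # p) y" using p e' by (simp add: awalk_Cons_iff)
  moreover have "a = (w ?e, pos (head \<Gamma> ?e) - pos x)"
    using e' by (simp add: transition_def)
  ultimately show ?case using p(2) by (intro exI[of _ "?e # p"] exI[of _ y]) simp
qed

section \<open>The growth series\<close>

definition ball_points :: "'v \<Rightarrow> (nat \<times> 'h) set" where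
  "ball_points x = {(a, pos y) | a y. y \<in> verts \<Gamma> \<and> weighted_dist \<Gamma> w x y \<le> enat a}"

text \<open>
  The monoid generated by \<open>(1, 0)\<close> supplies the slack between the weight of a walk and the radius
  of the ball.
\<close>

lemma ball_points_eq:
  assumes x: "x \<in> verts \<Gamma>"
  shows "ball_points x = {(0, pos x)} +
    (\<Union>q\<in>orbits L (verts \<Gamma>) actV. {z. run (transition ` arcs \<Gamma>) (orb x) z q}) + monoid_span {(1, 0)}"
    (is "_ = {_} + ?R + _")
proof -
  have sub: "monoid_span {(1, 0)} = {(k :: nat, 0 :: 'h) | k. True}"
  proof
    show "monoid_span {(1, 0)} \<subseteq> {(k :: nat, 0 :: 'h) | k. True}"
      by (rule monoid_span_least) (auto simp: zero_prod_def)
    have "(k, 0) \<in> monoid_span {(1 :: nat, 0 :: 'h)}" for k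
    proof (induction k)
      case (Suc k)
      from monoid_span_step[OF _ this] show ?case by simp
    qed (simp add: monoid_span_zero flip: zero_prod_def)
    then show "{(k :: nat, 0 :: 'h) | k. True} \<subseteq> monoid_span {(1, 0)}" by auto
  qed
  have R: "z \<in> ?R \<longleftrightarrow> (\<exists>p y. awalk x p y \<and> z = ((\<Sum>e\<leftarrow>p. w e), pos y - pos x))" for z
  proof
    assume "z \<in> ?R"
    then show "\<exists>p y. awalk x p y \<and> z = ((\<Sum>e\<leftarrow>p. w e), pos y - pos x)"
      using awalk_of_run[OF _ x refl] by blast
  next
    assume "\<exists>p y. awalk x p y \<and> z = ((\<Sum>e\<leftarrow>p. w e), pos y - pos x)"
    then obtain p y where "awalk x p y" "z = ((\<Sum>e\<leftarrow>p. w e), pos y - pos x)" by blast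
    then have "run (transition ` arcs \<Gamma>) (orb x) z (orb y)" "y \<in> verts \<Gamma>"
      using run_of_awalk awalk_last_in_verts by blast+
    then show "z \<in> ?R" unfolding orbits_def by blast
  qed
  show ?thesis
  proof (intro Set.set_eqI iffI)
    fix z assume "z \<in> ball_points x"
    then obtain a y p where z: "z = (a, pos y)" "awalk x p y" "(\<Sum>e\<leftarrow>p. w e) \<le> a"
      by (auto simp: ball_points_def weighted_dist_le_iff)
    let ?k = "\<Sum>e\<leftarrow>p. w e"
    have "(?k, pos y - pos x) \<in> ?R" using R z(2) by blast
    moreover have "(a - ?k, 0) \<in> monoid_span {(1, 0 :: 'h)}" unfolding sub by blast
    moreover have "z = (0, pos x) + (?k, pos y - pos x) + (a - ?k, 0)" using z by simp
    ultimately show "z \<in> {(0, pos x)} + ?R + monoid_span {(1, 0)}"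
      using set_plus_intro singletonI by metis
  next
    fix z assume "z \<in> {(0, pos x)} + ?R + monoid_span {(1, 0)}"
    then obtain r k where r: "r \<in> ?R" "z = (0, pos x) + r + (k, 0)"
      unfolding sub by (elim set_plus_elim) blast
    then obtain p y where "awalk x p y" "r = ((\<Sum>e\<leftarrow>p. w e), pos y - pos x)"
      using R by blast
    then have "awalk x p y" "z = ((\<Sum>e\<leftarrow>p. w e) + k, pos y)"
      using r(2) by simp_all
    moreover from this have "weighted_dist \<Gamma> w x y \<le> enat ((\<Sum>e\<leftarrow>p. w e) + k)"
      by (auto simp: weighted_dist_le_iff)
    ultimately show "z \<in> ball_points x"
      using awalk_last_in_verts by (auto simp: ball_points_def)
  qed
qed

lemma semilinear_ball_points:
  assumes "x \<in> verts \<Gamma>" shows "semilinear (ball_points x)"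
proof -
  have "semilinear (monoid_span {(1 :: nat, 0 :: 'h)})"
    by (rule semilinear_monoid_span[OF semilinear_singleton])
  then show ?thesis
    unfolding ball_points_eq[OF assms]
    by (intro semilinear_plus semilinear_singleton semilinear_UN finite_vert_orbits
        semilinear_runs finite_transitions)
qed

lemma finite_ball:
  assumes x: "x \<in> verts \<Gamma>"
  shows "finite {y \<in> verts \<Gamma>. weighted_dist \<Gamma> w x y \<le> enat a}" (is "finite ?B")
proof -
  let ?S = "{z. fst z \<le> a \<and> (\<exists>p q. run (transition ` arcs \<Gamma>) p z q)}"
  have "finite ?S"
    by (rule finite_light_runs[OF finite_transitions]) (auto simp: transition_def weight_pos)
  moreover have "pos ` ?B \<subseteq> (\<lambda>z. snd z + pos x) ` ?S"
  proof (rule image_subsetI)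
    fix y assume "y \<in> ?B"
    then obtain p where p: "awalk x p y" "(\<Sum>e\<leftarrow>p. w e) \<le> a"
      by (auto simp: weighted_dist_le_iff)
    then show "pos y \<in> (\<lambda>z. snd z + pos x) ` ?S"
      using run_of_awalk[OF p(1)]
      by (intro image_eqI[of _ _ "((\<Sum>e\<leftarrow>p. w e), pos y - pos x)"]) auto
  qed
  ultimately have "finite (pos ` ?B)" using finite_surj by blast
  then show ?thesis
    by (rule finite_imageD) (rule inj_on_subset[OF pos_inj], blast)
qed

lemma \<iota>_one: "\<iota> \<one>\<^bsub>L\<^esub> = 0"
  using \<iota>_mult[of "\<one>\<^bsub>L\<^esub>" "\<one>\<^bsub>L\<^esub>"] by simp

text \<open>
  This translates generation inside the group \<open>L\<^sup>d\<close> to generation in the additive monoid of coordinate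
  tuples.
\<close>

lemma submonoid_coordinates:
  assumes "A \<subseteq> carrier (product_group (UNIV :: 'd set) (\<lambda>_. L))"
    and N: "N = (\<lambda>H. submonoid H (product_group UNIV (\<lambda>_. L))) hull A"
      "submonoid N (product_group (UNIV :: 'd set) (\<lambda>_. L))"
  shows "(\<lambda>u i. \<iota> (u i)) ` N = monoid_span ((\<lambda>u i. \<iota> (u i)) ` A)"
proof
  let ?J = "\<lambda>u (i :: 'd). \<iota> (u i)" and ?G = "product_group (UNIV :: 'd set) (\<lambda>_. L)"
  have mult: "?J (u \<otimes>\<^bsub>?G\<^esub> v) = ?J u + ?J v" if "u \<in> carrier ?G" "v \<in> carrier ?G" for u v
    using that by (auto simp: \<iota>_mult PiE_iff)
  have one: "?J \<one>\<^bsub>?G\<^esub> = 0" by (auto simp: \<iota>_one)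
  \<comment> \<open>The elements with coordinates in the span form a submonoid containing \<open>A\<close>, hence all of \<open>N\<close>.\<close>
  let ?M = "{u \<in> carrier ?G. ?J u \<in> monoid_span (?J ` A)}"
  interpret G: group ?G by (rule product_group) (rule group_axioms)
  have "submonoid ?M ?G"
  proof
    show "\<one>\<^bsub>?G\<^esub> \<in> ?M" using one monoid_span_zero[of "?J ` A"] G.one_closed by (simp only: mem_Collect_eq)
    show "u \<otimes>\<^bsub>?G\<^esub> v \<in> ?M" if "u \<in> ?M" "v \<in> ?M" for u v
      using that mult[of u v] monoid_span_add[of "?J u" "?J ` A" "?J v"] G.m_closed[of u v]
      by (simp only: mem_Collect_eq)
  qed blast
  moreover have "A \<subseteq> ?M" using assms(1) by (auto intro: monoid_span_base)
  ultimately have "N \<subseteq> ?M" unfolding N(1) by (intro hull_minimal)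
  then show "?J ` N \<subseteq> monoid_span (?J ` A)" by auto
  show "monoid_span (?J ` A) \<subseteq> ?J ` N"
  proof (rule monoid_span_least)
    have "A \<subseteq> N" unfolding N(1) by (rule hull_subset)
    then show "?J ` A \<subseteq> ?J ` N" by (rule image_mono)
    show "0 \<in> ?J ` N" using one submonoid.one_closed[OF N(2)] by (metis image_eqI)
    show "x + y \<in> ?J ` N" if xy: "x \<in> ?J ` N" "y \<in> ?J ` N" for x y
    proof -
      obtain u v where uv: "x = ?J u" "y = ?J v" "u \<in> N" "v \<in> N" using xy by auto
      then have "x + y = ?J (u \<otimes>\<^bsub>?G\<^esub> v)"
        using mult[of u v] submonoid.subset[OF N(2)] by (simp only: subset_iff)
      then show ?thesis using submonoid.m_closed[OF N(2) uv(3,4)] by (rule image_eqI)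
    qed
  qed
qed

lemma fg_module_coordinates:
  fixes N :: "('d \<Rightarrow> 'l) set" and Y :: "('d \<Rightarrow> 'v) set"
  assumes N: "fg_submonoid (product_group (UNIV :: 'd set) (\<lambda>_. L)) N"
    and Y: "Y \<subseteq> UNIV \<rightarrow> verts \<Gamma>" "fg_module N (tuple_act actV) Y"
  shows "fg_subset ((\<lambda>y i. pos (y i)) ` Y)"
proof -
  obtain A where A: "finite A" "A \<subseteq> carrier (product_group (UNIV :: 'd set) (\<lambda>_. L))"
    "N = (\<lambda>H. submonoid H (product_group UNIV (\<lambda>_. L))) hull A"
    "submonoid N (product_group (UNIV :: 'd set) (\<lambda>_. L))"
    using N by (auto simp: fg_submonoid_def)
  obtain X where X: "finite X" "X \<subseteq> Y" "Y = (\<Union>x\<in>X. (\<lambda>u. tuple_act actV u x) ` N)"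
    using Y(2) by (auto simp: fg_module_def)
  have act: "(\<lambda>i. pos (tuple_act actV u x i)) = (\<lambda>i. pos (x i)) + (\<lambda>i. \<iota> (u i))"
    if "u \<in> N" "x \<in> X" for u x
  proof
    fix i
    have "u i \<in> carrier L" using submonoid.subset[OF A(4)] that(1) by (auto simp: PiE_iff)
    moreover have "x i \<in> verts \<Gamma>" using X(2) Y(1) that(2) by auto
    ultimately show "pos (tuple_act actV u x i) = ((\<lambda>i. pos (x i)) + (\<lambda>i. \<iota> (u i))) i"
      by (simp add: tuple_act_def pos_act add.commute)
  qed
  have "(\<lambda>y i. pos (y i)) ` Y = (\<lambda>x i. pos (x i)) ` X + (\<lambda>u i. \<iota> (u i)) ` N"
  proof (intro Set.set_eqI iffI)
    fix z assume "z \<in> (\<lambda>y i. pos (y i)) ` Y"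
    then obtain u x where "x \<in> X" "u \<in> N" "z = (\<lambda>i. pos (tuple_act actV u x i))"
      unfolding X(3) by blast
    then show "z \<in> (\<lambda>x i. pos (x i)) ` X + (\<lambda>u i. \<iota> (u i)) ` N"
      using act[of u x] by (simp only:) (intro set_plus_intro imageI)
  next
    fix z assume "z \<in> (\<lambda>x i. pos (x i)) ` X + (\<lambda>u i. \<iota> (u i)) ` N"
    then obtain u x where ux: "x \<in> X" "u \<in> N" "z = (\<lambda>i. pos (x i)) + (\<lambda>i. \<iota> (u i))"
      by (auto elim!: set_plus_elim)
    then have "z = (\<lambda>i. pos (tuple_act actV u x i))" using act[of u x] by simp
    moreover have "tuple_act actV u x \<in> Y" using ux X(3) by blast
    ultimately show "z \<in> (\<lambda>y i. pos (y i)) ` Y" by (rule image_eqI)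
  qed
  also have "(\<lambda>u i. \<iota> (u i)) ` N = monoid_span ((\<lambda>u i. \<iota> (u i)) ` A)"
    by (rule submonoid_coordinates[OF A(2-4)])
  finally show ?thesis
    unfolding fg_subset_def
    by (intro exI[of _ "(\<lambda>x i. pos (x i)) ` X"] exI[of _ "(\<lambda>u i. \<iota> (u i)) ` A"])
      (simp add: X(1) A(1))
qed

text \<open>
  The points of the balls correspond to the tuples of pairs \<open>(a\<^sub>i, pos y\<^sub>i)\<close>. Such a tuple carries its
  radius vector with it, as its degree, so a single semilinear set \<open>W\<close> describes all the balls and its
  fibres over the degrees are the individual ones.
\<close>

lemma ball_series_rational:
  fixes N :: "('d::finite \<Rightarrow> 'l) set" and Y :: "('d \<Rightarrow> 'v) set"
  assumes x: "x \<in> verts \<Gamma>"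
    and Y: "Y \<subseteq> UNIV \<rightarrow> verts \<Gamma>" "fg_subset ((\<lambda>y i. pos (y i)) ` Y)"
  shows "unit_rational (ball_series \<Gamma> w x Y)" "\<And>a. finite (ball_set \<Gamma> w x Y a)"
proof -
  show fin: "finite (ball_set \<Gamma> w x Y a)" for a
  proof (rule finite_subset)
    show "ball_set \<Gamma> w x Y a \<subseteq> (UNIV \<rightarrow>\<^sub>E
        (\<Union>i. {y \<in> verts \<Gamma>. weighted_dist \<Gamma> w x y \<le> enat (Poly_Mapping.lookup a i)}))"
      using Y(1) by (fastforce simp: ball_set_def)
    show "finite (UNIV \<rightarrow>\<^sub>E
        (\<Union>i. {y \<in> verts \<Gamma>. weighted_dist \<Gamma> w x y \<le> enat (Poly_Mapping.lookup a i)}) ::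
        ('d \<Rightarrow> 'v) set)"
      by (intro finite_PiE finite_UN_I finite_ball x) auto
  qed
  define deg :: "('d \<Rightarrow> nat \<times> 'h) \<Rightarrow> ('d \<Rightarrow>\<^sub>0 nat)" where
    "deg f = Abs_poly_mapping (\<lambda>i. fst (f i))" for f
  have deg_lookup: "Poly_Mapping.lookup (deg f) i = fst (f i)" for f i
    by (simp add: deg_def)
  have deg_add: "deg (f + g) = deg f + deg g" for f g
    by (rule poly_mapping_eqI) (simp add: deg_lookup lookup_add)
  let ?h = "\<lambda>(f :: 'd \<Rightarrow> nat \<times> 'h) i. snd (f i)"
  define W where "W = {f \<in> {f. \<forall>i. f i \<in> ball_points x}. ?h f \<in> (\<lambda>y i. pos (y i)) ` Y}"
  have "semilinear W"
    unfolding W_def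
    by (rule semilinear_vimage[OF _ _ semilinear_funs[OF semilinear_ball_points[OF x]] Y(2)]) auto
  have W: "{f \<in> W. deg f = a} =
      (\<lambda>y i. (Poly_Mapping.lookup a i, pos (y i))) ` ball_set \<Gamma> w x Y a" for a
  proof (intro Set.set_eqI iffI)
    fix f assume "f \<in> {f \<in> W. deg f = a}"
    then obtain y where f: "\<And>i. f i \<in> ball_points x" "?h f = (\<lambda>i. pos (y i))" "y \<in> Y" "deg f = a"
      by (auto simp: W_def)
    have f_eq: "f i = (Poly_Mapping.lookup a i, pos (y i))" for i
      using fun_cong[OF f(2), of i] deg_lookup[of f i] f(4) by (cases "f i") simp
    have "weighted_dist \<Gamma> w x (y i) \<le> enat (Poly_Mapping.lookup a i)" for i
    proof -
      obtain v where v: "v \<in> verts \<Gamma>" "pos v = pos (y i)"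
        "weighted_dist \<Gamma> w x v \<le> enat (Poly_Mapping.lookup a i)"
        using f(1)[of i] f_eq[of i] by (auto simp: ball_points_def)
      have "y i \<in> verts \<Gamma>" using Y(1) f(3) by auto
      then have "v = y i" using v pos_inj by (auto dest: inj_onD)
      then show ?thesis using v by simp
    qed
    then have "y \<in> ball_set \<Gamma> w x Y a" using f(3) by (simp add: ball_set_def)
    moreover have "f = (\<lambda>i. (Poly_Mapping.lookup a i, pos (y i)))" using f_eq by auto
    ultimately show "f \<in> (\<lambda>y i. (Poly_Mapping.lookup a i, pos (y i))) ` ball_set \<Gamma> w x Y a"
      by blast
  next
    fix f assume "f \<in> (\<lambda>y i. (Poly_Mapping.lookup a i, pos (y i))) ` ball_set \<Gamma> w x Y a"
    then obtain y where f: "y \<in> ball_set \<Gamma> w x Y a" "f = (\<lambda>i. (Poly_Mapping.lookup a i, pos (y i)))"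
      by blast
    have "f i \<in> ball_points x" for i
      using f Y(1) by (auto simp: ball_points_def ball_set_def)
    moreover have "?h f \<in> (\<lambda>y i. pos (y i)) ` Y" using f by (auto simp: ball_set_def)
    moreover have "deg f = a" by (rule poly_mapping_eqI) (simp add: deg_lookup f(2))
    ultimately show "f \<in> {f \<in> W. deg f = a}" by (simp add: W_def)
  qed
  have inj: "inj_on (\<lambda>y i. (Poly_Mapping.lookup a i, pos (y i))) (ball_set \<Gamma> w x Y a)" for a
  proof (rule inj_onI)
    fix y z assume yz: "y \<in> ball_set \<Gamma> w x Y a" "z \<in> ball_set \<Gamma> w x Y a"
      "(\<lambda>i. (Poly_Mapping.lookup a i, pos (y i))) = (\<lambda>i. (Poly_Mapping.lookup a i, pos (z i)))"
    show "y = z"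
    proof
      fix i
      have "y i \<in> verts \<Gamma>" "z i \<in> verts \<Gamma>" using yz Y(1) by (auto simp: ball_set_def)
      then show "y i = z i" using fun_cong[OF yz(3), of i] pos_inj by (auto dest: inj_onD)
    qed
  qed
  have "counting_series deg W = ball_series \<Gamma> w x Y"
    by (rule ext) (simp add: counting_series_def ball_series_def W card_image[OF inj])
  moreover have "finite_fibres deg W"
    unfolding finite_fibres_def W using fin by blast
  ultimately show "unit_rational (ball_series \<Gamma> w x Y)"
    using counting_series_semilinear_rational[OF deg_add \<open>semilinear W\<close>] by simp
qed

end

theorem theorem3p5:
  fixes n :: nat
    and \<Gamma> :: "('v, 'e) pre_digraph"
    and w :: "'e \<Rightarrow> nat"
    and L :: "('l, 'm) monoid_scheme"
    and actV :: "'l \<Rightarrow> 'v \<Rightarrow> 'v"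
    and actE :: "'l \<Rightarrow> 'e \<Rightarrow> 'e"
    and x\<^sub>0 :: 'v
    and N :: "('d::finite \<Rightarrow> 'l) set"
    and Y :: "('d \<Rightarrow> 'v) set"
  assumes "periodic_graph n \<Gamma> w L actV actE"
    and "x\<^sub>0 \<in> verts \<Gamma>"
    and "fg_submonoid (product_group (UNIV :: 'd set) (\<lambda>_. L)) N"
    and "is_submodule N (tuple_act actV) (UNIV \<rightarrow> verts \<Gamma>) Y"
    and "fg_module N (tuple_act actV) Y"
  shows "is_rational_series (ball_series \<Gamma> w x\<^sub>0 Y) \<and>
    is_rational_series (sphere_series \<Gamma> w x\<^sub>0 Y)"
proof -
  interpret periodic_graph n \<Gamma> w L actV actE by fact
  obtain \<iota> :: "'l \<Rightarrow> nat \<Rightarrow> int" and pos :: "'v \<Rightarrow> nat \<Rightarrow> int" where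
    "\<And>u v. u \<in> carrier L \<Longrightarrow> v \<in> carrier L \<Longrightarrow> \<iota> (u \<otimes>\<^bsub>L\<^esub> v) = \<iota> u + \<iota> v"
    "inj_on pos (verts \<Gamma>)"
    "\<And>u x. u \<in> carrier L \<Longrightarrow> x \<in> verts \<Gamma> \<Longrightarrow> pos (actV u x) = \<iota> u + pos x"
    using equivariant_embedding by blast
  then interpret embedded_periodic_graph n \<Gamma> w L actV actE \<iota> pos
    by unfold_locales auto
  have Y: "Y \<subseteq> UNIV \<rightarrow> verts \<Gamma>" using assms(4) by (simp add: is_submodule_def)
  note ball = ball_series_rational[OF assms(2) Y fg_module_coordinates[OF assms(3) Y assms(5)]]
  have "unit_rational (sphere_series \<Gamma> w x\<^sub>0 Y)"
    using sphere_rational_of_ball_rational[of Y "weighted_dist \<Gamma> w x\<^sub>0"] ball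
    by (simp add: ball_set_def sphere_set_def ball_series_def sphere_series_def)
  then show ?thesis using ball(1) unit_rational_imp_rational by blast
qed

end
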